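(* For any finite group $G$ and any non-zero function $f:G\to\mathbb{C}$, \[ |\operatorname{supp}(f)|\cdot|\operatorname{min-supp}(\hat f)|\ \ge\ |G| . \]
   Context: Let $G$ be a finite group and let $\rho_1,\dots,\rho_t$ be the irreducible complex representations of $G$ (one from each isomorphism class), $\rho_i:G\to GL(W_i)$ with $d_i=\dim W_i$, chosen to be unitary (each $W_i$ is a finite-dimensional complex inner product space and each $\rho_i(x)$ is unitary). For $f:G\to\mathbb{C}$, $\operatorname{supp}(f)=\{x\in G: f(x)\neq 0\}$, and the Fourier transform of $f$ is given by the linear maps $\hat f(\rho_i)=\sum_{x\in G}f(x)\rho_i(x):W_i\to W_i$. Given orthonormal bases $E_i$ of $W_i$ for $i=1,\dots,t$, view $\hat f(\rho_i)$ as a $d_i\times d_i$ matrix in the basis $E_i$, let $\operatorname{supp}(\hat f(\rho_i))$ be its set of non-zero entries, and put \[ |\operatorname{supp}(\hat f)|=\sum_{i=1}^t d_i\,|\operatorname{supp}(\hat f(\rho_i))| . \] The minimum support-size of $\hat f$ is $|\operatorname{min-supp}(\hat f)|=\min_{E_1,\dots,E_t}|\operatorname{supp}(\hat f)|$, the minimum being over all choices of orthonormal bases $E_1,\dots,E_t$ of $W_1,\dots,W_t$. *)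

theory Defs
  imports "HOL-Algebra.Group" "Jordan_Normal_Form.Schur_Decomposition"
begin

text \<open>
  A finite-dimensional complex inner product space is taken to be \<open>carrier_vec n\<close> over the
  complex numbers with the standard inner product \<open>v \<bullet>c w\<close>, which is linear in \<open>v\<close> and conjugate
  linear in \<open>w\<close>; linear maps are given by their action \<open>A *\<^sub>v v\<close>.
\<close>

definition GL :: "nat \<Rightarrow> complex mat monoid" where
  "GL n = units_of (ring_mat TYPE(complex) n ())"

definition representation :: "('g, 'b) monoid_scheme \<Rightarrow> nat \<Rightarrow> ('g \<Rightarrow> complex mat) \<Rightarrow> bool" where
  "representation G n \<rho> \<longleftrightarrow> \<rho> \<in> hom G (GL n)"

definition linear_subspace :: "nat \<Rightarrow> complex vec set \<Rightarrow> bool" where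
  "linear_subspace n V \<longleftrightarrow>
     V \<subseteq> carrier_vec n \<and> 0\<^sub>v n \<in> V \<and>
     (\<forall>v\<in>V. \<forall>w\<in>V. v + w \<in> V) \<and> (\<forall>c. \<forall>v\<in>V. c \<cdot>\<^sub>v v \<in> V)"

definition irreducible_representation ::
    "('g, 'b) monoid_scheme \<Rightarrow> nat \<Rightarrow> ('g \<Rightarrow> complex mat) \<Rightarrow> bool" where
  "irreducible_representation G n \<rho> \<longleftrightarrow>
     representation G n \<rho> \<and> n > 0 \<and>
     (\<forall>V. linear_subspace n V \<and> (\<forall>x\<in>carrier G. \<forall>v\<in>V. \<rho> x *\<^sub>v v \<in> V)
        \<longrightarrow> V = {0\<^sub>v n} \<or> V = carrier_vec n)"

definition isomorphic_representations ::
    "('g, 'b) monoid_scheme \<Rightarrow> nat \<Rightarrow> ('g \<Rightarrow> complex mat) \<Rightarrow> nat \<Rightarrow> ('g \<Rightarrow> complex mat) \<Rightarrow> bool" where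
  "isomorphic_representations G n \<rho> m \<sigma> \<longleftrightarrow>
     n = m \<and> (\<exists>P\<in>carrier (GL n). \<forall>x\<in>carrier G. P * \<rho> x = \<sigma> x * P)"

text \<open>Completeness is required with respect to all irreducible complex representations,
  unitary or not.\<close>

definition complete_irreducibles ::
    "('g, 'b) monoid_scheme \<Rightarrow> nat \<Rightarrow> (nat \<Rightarrow> nat) \<Rightarrow> (nat \<Rightarrow> 'g \<Rightarrow> complex mat) \<Rightarrow> bool" where
  "complete_irreducibles G t d \<rho> \<longleftrightarrow>
     (\<forall>i\<in>{1..t}. irreducible_representation G (d i) (\<rho> i)) \<and>
     (\<forall>i\<in>{1..t}. \<forall>j\<in>{1..t}. i \<noteq> j \<longrightarrow> \<not> isomorphic_representations G (d i) (\<rho> i) (d j) (\<rho> j)) \<and>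
     (\<forall>n \<sigma>. irreducible_representation G n \<sigma> \<longrightarrow>
        (\<exists>i\<in>{1..t}. isomorphic_representations G n \<sigma> (d i) (\<rho> i)))"

definition unitary_matrix :: "nat \<Rightarrow> complex mat \<Rightarrow> bool" where
  "unitary_matrix n A \<longleftrightarrow>
     A \<in> carrier_mat n n \<and> mat_adjoint A * A = 1\<^sub>m n \<and> A * mat_adjoint A = 1\<^sub>m n"

definition fun_supp :: "('g, 'b) monoid_scheme \<Rightarrow> ('g \<Rightarrow> complex) \<Rightarrow> 'g set" where
  "fun_supp G f = {x \<in> carrier G. f x \<noteq> 0}"

text \<open>The sum over \<open>x\<close> of \<open>f x \<cdot>\<^sub>m \<rho> x\<close>, written entrywise, since matrices of unspecified size
  do not form a type-class monoid.\<close>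

definition fourier_transform ::
    "('g, 'b) monoid_scheme \<Rightarrow> ('g \<Rightarrow> complex) \<Rightarrow> nat \<Rightarrow> ('g \<Rightarrow> complex mat) \<Rightarrow> complex mat" where
  "fourier_transform G f n \<rho> = mat n n (\<lambda>(j, k). \<Sum>x\<in>carrier G. f x * \<rho> x $$ (j, k))"

text \<open>A list of \<open>n\<close> orthonormal vectors of an \<open>n\<close>-dimensional space is automatically a basis.\<close>

definition orthonormal_basis :: "nat \<Rightarrow> complex vec list \<Rightarrow> bool" where
  "orthonormal_basis n E \<longleftrightarrow>
     length E = n \<and> set E \<subseteq> carrier_vec n \<and>
     (\<forall>j<n. \<forall>k<n. E ! j \<bullet>c E ! k = (if j = k then 1 else 0))"

text \<open>Column \<open>k\<close> holds the coordinates of \<open>A *\<^sub>v E ! k\<close> with respect to the orthonormal basis \<open>E\<close>;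
  \<open>matrix_in_basis_coordinates\<close> below confirms this.\<close>

definition matrix_in_basis :: "nat \<Rightarrow> complex vec list \<Rightarrow> complex mat \<Rightarrow> complex mat" where
  "matrix_in_basis n E A = mat n n (\<lambda>(j, k). (A *\<^sub>v E ! k) \<bullet>c E ! j)"

definition mat_supp :: "complex mat \<Rightarrow> (nat \<times> nat) set" where
  "mat_supp A = {(j, k). j < dim_row A \<and> k < dim_col A \<and> A $$ (j, k) \<noteq> 0}"

definition fourier_supp_size ::
    "('g, 'b) monoid_scheme \<Rightarrow> nat \<Rightarrow> (nat \<Rightarrow> nat) \<Rightarrow> (nat \<Rightarrow> 'g \<Rightarrow> complex mat) \<Rightarrow>
      ('g \<Rightarrow> complex) \<Rightarrow> (nat \<Rightarrow> complex vec list) \<Rightarrow> nat" where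
  "fourier_supp_size G t d \<rho> f E =
     (\<Sum>i=1..t. d i * card (mat_supp (matrix_in_basis (d i) (E i) (fourier_transform G f (d i) (\<rho> i)))))"

definition fourier_min_supp_size ::
    "('g, 'b) monoid_scheme \<Rightarrow> nat \<Rightarrow> (nat \<Rightarrow> nat) \<Rightarrow> (nat \<Rightarrow> 'g \<Rightarrow> complex mat) \<Rightarrow>
      ('g \<Rightarrow> complex) \<Rightarrow> nat" where
  "fourier_min_supp_size G t d \<rho> f =
     (LEAST s. \<exists>E. (\<forall>i\<in>{1..t}. orthonormal_basis (d i) (E i)) \<and> s = fourier_supp_size G t d \<rho> f E)"

lemma matrix_in_basis_coordinates:
  assumes E: "orthonormal_basis n E" and A: "A \<in> carrier_mat n n"
  shows "invertible_mat (mat_of_cols n E)"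
    and "A * mat_of_cols n E = mat_of_cols n E * matrix_in_basis n E A"
proof -
  define P where "P = mat_of_cols n E"
  define Q where "Q = mat_of_rows n (map conjugate E)"
  have len: "length E = n" and Ec: "\<And>k. k < n \<Longrightarrow> E ! k \<in> carrier_vec n"
    using E by (auto simp: orthonormal_basis_def)
  have P: "P \<in> carrier_mat n n" and Q: "Q \<in> carrier_mat n n"
    by (auto simp: P_def Q_def len mat_of_cols_def mat_of_rows_def)
  have colP: "col P k = E ! k" if "k < n" for k
    using that Ec[OF that] by (simp add: P_def len)
  have rowQ: "row Q j = conjugate (E ! j)" if "j < n" for j
    using that Ec[OF that] by (simp add: Q_def len)
  have QP: "Q * P = 1\<^sub>m n"
  proof (rule eq_matI)
    fix j k assume "j < dim_row (1\<^sub>m n :: complex mat)" "k < dim_col (1\<^sub>m n :: complex mat)"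
    then have jk: "j < n" "k < n" by auto
    have "(Q * P) $$ (j, k) = conjugate (E ! j) \<bullet> E ! k"
      using jk P Q by (simp add: colP rowQ)
    also have "\<dots> = E ! k \<bullet>c E ! j"
      using Ec jk by (intro comm_scalar_prod[of _ n]) auto
    also have "\<dots> = 1\<^sub>m n $$ (j, k)"
      using E jk by (auto simp: orthonormal_basis_def)
    finally show "(Q * P) $$ (j, k) = 1\<^sub>m n $$ (j, k)" .
  qed (use P Q in auto)
  have PQ: "P * Q = 1\<^sub>m n"
    using mat_mult_left_right_inverse[OF Q P QP] .
  show "invertible_mat (mat_of_cols n E)"
    using P Q PQ QP unfolding P_def[symmetric] invertible_mat_def inverts_mat_def by auto
  have M: "matrix_in_basis n E A = Q * (A * P)"
  proof (rule eq_matI)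
    fix j k assume "j < dim_row (Q * (A * P))" "k < dim_col (Q * (A * P))"
    then have jk: "j < n" "k < n" using P Q by auto
    have "(Q * (A * P)) $$ (j, k) = conjugate (E ! j) \<bullet> (A *\<^sub>v E ! k)"
      using jk P Q A by (simp add: rowQ colP mult_mat_vec_def)
    also have "\<dots> = (A *\<^sub>v E ! k) \<bullet>c E ! j"
      using Ec jk A by (intro comm_scalar_prod[of _ n]) auto
    finally show "matrix_in_basis n E A $$ (j, k) = (Q * (A * P)) $$ (j, k)"
      using jk by (simp add: matrix_in_basis_def)
  qed (use P Q in \<open>auto simp: matrix_in_basis_def\<close>)
  have "P * (Q * (A * P)) = (P * Q) * (A * P)"
    using P Q A by (intro assoc_mult_mat[symmetric]) auto
  then show "A * mat_of_cols n E = mat_of_cols n E * matrix_in_basis n E A"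
    unfolding M P_def[symmetric] using PQ P A by simp
qed

end

theory Submission
  imports Defs "Jordan_Normal_Form.Spectral_Radius" "HOL-Library.Function_Algebras"
begin

text \<open>
  The inequality compares two bounds for the largest value of \<open>|f|\<close>. Fourier inversion writes
  \<open>|G| f(x)\<close> as the sum over \<open>i\<close> of \<open>d i\<close> times the Frobenius inner product of \<open>F(\<rho> i)\<close>, the
  Fourier transform at \<open>\<rho> i\<close>, with \<open>\<rho> i x\<close>. The Frobenius product does not see the choice of
  orthonormal basis, so in every choice of bases it is a sum over the non-zero entries of the
  matrix of \<open>F(\<rho> i)\<close>. The matrix of \<open>\<rho> i x\<close> is unitary and has entries of modulus at most \<open>1\<close>;
  for the same reason every entry of \<open>F(\<rho> i)\<close>, being a sum of \<open>f(x)\<close> times entries of unitary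
  matrices, is at most the sum of \<open>|f|\<close>, hence at most \<open>|supp f|\<close> times the maximum of \<open>|f|\<close>.
  At a point where \<open>|f|\<close> is maximal this gives
  \<open>|G| max|f| \<le> |supp of the transform| |supp f| max|f|\<close>, and the maximum cancels.

  The substance is therefore \<open>fourier_inversion\<close>. It rests on two facts. The first is
  \<open>schur_orthogonality\<close>: averaging an elementary matrix over \<open>G\<close> produces an intertwiner, and
  Schur's lemma determines all intertwiners between irreducible representations; so
  the proposed right-hand side has the same Fourier transform as \<open>|G| f\<close>. The second is
  \<open>matrix_coefficients_complete\<close>: only the zero function is orthogonal to all matrix
  coefficients. The functions orthogonal to all of them form a space invariant
  under right translation; were it non-zero, a minimal invariant subspace would carry an irreducible
  representation, by hypothesis isomorphic to some \<open>\<rho> i\<close>. But a function in it is recovered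
  from its translates by evaluation at the identity, hence is a combination of matrix coefficients
  of \<open>\<rho> i\<close>, and so is orthogonal to itself.
\<close>

section \<open>Matrix entries\<close>

lemma index_mult_mat_sum:
  assumes "A \<in> carrier_mat n m" "B \<in> carrier_mat m p" "i < n" "j < p"
  shows "(A * B) $$ (i, j) = (\<Sum>l<m. A $$ (i, l) * B $$ (l, j))"
  using assms by (auto simp: scalar_prod_def lessThan_atLeast0 intro!: sum.cong)

lemma index_mult_mat_vec_sum:
  assumes "A \<in> carrier_mat n m" "v \<in> carrier_vec m" "i < n"
  shows "(A *\<^sub>v v) $ i = (\<Sum>l<m. A $$ (i, l) * v $ l)"
  using assms by (auto simp: scalar_prod_def lessThan_atLeast0 intro!: sum.cong)

lemma mat_adjoint_carrier:
  "A \<in> carrier_mat n m \<Longrightarrow> mat_adjoint A \<in> carrier_mat m n"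
  by (auto simp: mat_adjoint_def)

lemma index_mat_adjoint:
  fixes A :: "complex mat"
  assumes "A \<in> carrier_mat n m" "i < m" "j < n"
  shows "mat_adjoint A $$ (i, j) = cnj (A $$ (j, i))"
  using assms by (auto simp: mat_adjoint_def mat_of_rows_def)

lemma unitary_matrix_columns:
  assumes "unitary_matrix n A" "j < n" "k < n"
  shows "(\<Sum>l<n. A $$ (l, j) * cnj (A $$ (l, k))) = (if j = k then 1 else 0)"
proof -
  have A: "A \<in> carrier_mat n n" and 1: "mat_adjoint A * A = 1\<^sub>m n"
    using assms by (auto simp: unitary_matrix_def)
  have "(\<Sum>l<n. A $$ (l, j) * cnj (A $$ (l, k))) = (mat_adjoint A * A) $$ (k, j)"
    unfolding index_mult_mat_sum[OF mat_adjoint_carrier[OF A] A assms(3,2)]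
    by (intro sum.cong) (use A assms in \<open>auto simp: index_mat_adjoint mult.commute\<close>)
  then show ?thesis using assms by (auto simp: 1)
qed

lemma eq_mat_by_mult_vec:
  fixes A B :: "complex mat"
  assumes A: "A \<in> carrier_mat n m" and B: "B \<in> carrier_mat n m"
    and eq: "\<And>v. v \<in> carrier_vec m \<Longrightarrow> A *\<^sub>v v = B *\<^sub>v v"
  shows "A = B"
proof (rule eq_matI)
  fix i j assume "i < dim_row B" "j < dim_col B"
  then have ij: "i < n" "j < m" using B by auto
  have "A *\<^sub>v unit_vec m j = B *\<^sub>v unit_vec m j" by (rule eq) auto
  then have "(A *\<^sub>v unit_vec m j) $ i = (B *\<^sub>v unit_vec m j) $ i" by simp
  then show "A $$ (i, j) = B $$ (i, j)"
    using A B ij by simp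
qed (use A B in auto)

section \<open>Schur's lemma\<close>

lemma representation_carrier:
  assumes "representation G n \<rho>" "x \<in> carrier G"
  shows "\<rho> x \<in> carrier_mat n n"
  using assms
  by (auto simp: representation_def GL_def hom_def units_of_def Units_def ring_mat_def Pi_iff)

lemma representation_mult:
  assumes "representation G n \<rho>" "x \<in> carrier G" "y \<in> carrier G"
  shows "\<rho> (x \<otimes>\<^bsub>G\<^esub> y) = \<rho> x * \<rho> y"
  using assms by (auto simp: representation_def GL_def hom_def units_of_def ring_mat_def)

lemma irreducible_representationD:
  assumes "irreducible_representation G n \<rho>"
  shows "representation G n \<rho>" "n > 0"
    "\<And>V. linear_subspace n V \<Longrightarrow> (\<And>x v. x \<in> carrier G \<Longrightarrow> v \<in> V \<Longrightarrow> \<rho> x *\<^sub>v v \<in> V) \<Longrightarrow>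
       V = {0\<^sub>v n} \<or> V = carrier_vec n"
  using assms by (auto simp: irreducible_representation_def)

text \<open>The kernel of \<open>T\<close> is an invariant subspace of the irreducible representation \<open>\<sigma>\<close>.\<close>

lemma intertwiner_zero_or_injective:
  assumes irr: "irreducible_representation G m \<sigma>" and T: "T \<in> carrier_mat n m"
    and \<rho>: "\<And>x. x \<in> carrier G \<Longrightarrow> \<rho> x \<in> carrier_mat n n"
    and com: "\<And>x. x \<in> carrier G \<Longrightarrow> T * \<sigma> x = \<rho> x * T"
  shows "T = 0\<^sub>m n m \<or> (\<forall>v\<in>carrier_vec m. T *\<^sub>v v = 0\<^sub>v n \<longrightarrow> v = 0\<^sub>v m)"
proof -
  note \<sigma> = representation_carrier[OF irreducible_representationD(1)[OF irr]]
  define K where "K = {v \<in> carrier_vec m. T *\<^sub>v v = 0\<^sub>v n}"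
  have "linear_subspace m K"
    using T by (auto simp: K_def linear_subspace_def mult_add_distrib_mat_vec mult_mat_vec)
  moreover have "\<sigma> x *\<^sub>v v \<in> K" if x: "x \<in> carrier G" and v: "v \<in> K" for x v
  proof -
    have vc: "v \<in> carrier_vec m" and Tv: "T *\<^sub>v v = 0\<^sub>v n" using v by (auto simp: K_def)
    have "T *\<^sub>v (\<sigma> x *\<^sub>v v) = (T * \<sigma> x) *\<^sub>v v"
      using T \<sigma>[OF x] vc by (intro assoc_mult_mat_vec[symmetric])
    also have "\<dots> = \<rho> x *\<^sub>v (T *\<^sub>v v)"
      unfolding com[OF x] using T \<rho>[OF x] vc by (intro assoc_mult_mat_vec)
    also have "\<dots> = 0\<^sub>v n" using Tv \<rho>[OF x] by auto
    finally show ?thesis using \<sigma>[OF x] vc by (auto simp: K_def)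
  qed
  ultimately consider "K = {0\<^sub>v m}" | "K = carrier_vec m"
    using irreducible_representationD(3)[OF irr] by blast
  then show ?thesis
  proof cases
    case 1
    then show ?thesis by (auto simp: K_def)
  next
    case 2
    have "T = 0\<^sub>m n m"
    proof (rule eq_mat_by_mult_vec[OF T])
      fix v :: "complex vec" assume "v \<in> carrier_vec m"
      then have "v \<in> K" using 2 by simp
      then show "T *\<^sub>v v = 0\<^sub>m n m *\<^sub>v v" by (auto simp: K_def)
    qed auto
    then show ?thesis ..
  qed
qed

text \<open>The range of \<open>T\<close> is an invariant subspace of the irreducible representation \<open>\<rho>\<close>.\<close>

lemma intertwiner_zero_or_surjective:
  assumes irr: "irreducible_representation G n \<rho>" and T: "T \<in> carrier_mat n m"
    and \<sigma>: "\<And>x. x \<in> carrier G \<Longrightarrow> \<sigma> x \<in> carrier_mat m m"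
    and com: "\<And>x. x \<in> carrier G \<Longrightarrow> T * \<sigma> x = \<rho> x * T"
  shows "T = 0\<^sub>m n m \<or> (\<lambda>v. T *\<^sub>v v) ` carrier_vec m = carrier_vec n"
proof -
  note \<rho> = representation_carrier[OF irreducible_representationD(1)[OF irr]]
  define R where "R = (\<lambda>v. T *\<^sub>v v) ` carrier_vec m"
  have "linear_subspace n R"
    unfolding linear_subspace_def
  proof (intro conjI ballI allI)
    show "R \<subseteq> carrier_vec n" using T by (auto simp: R_def)
    show "0\<^sub>v n \<in> R" unfolding R_def using T by (intro image_eqI[of _ _ "0\<^sub>v m"]) auto
    show "v + w \<in> R" if "v \<in> R" "w \<in> R" for v w
      using that T unfolding R_def
      by (auto simp: mult_add_distrib_mat_vec[symmetric])
    show "c \<cdot>\<^sub>v v \<in> R" if "v \<in> R" for c v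
      using that T unfolding R_def by (auto simp: mult_mat_vec[symmetric])
  qed
  moreover have "\<rho> x *\<^sub>v w \<in> R" if x: "x \<in> carrier G" and w: "w \<in> R" for x w
  proof -
    obtain v where vc: "v \<in> carrier_vec m" and wv: "w = T *\<^sub>v v" using w by (auto simp: R_def)
    have "T *\<^sub>v (\<sigma> x *\<^sub>v v) = (T * \<sigma> x) *\<^sub>v v"
      using T \<sigma>[OF x] vc by (intro assoc_mult_mat_vec[symmetric])
    also have "\<dots> = \<rho> x *\<^sub>v (T *\<^sub>v v)"
      unfolding com[OF x] using T \<rho>[OF x] vc by (intro assoc_mult_mat_vec)
    finally show ?thesis using \<sigma>[OF x] vc unfolding R_def wv by (metis imageI mult_mat_vec_carrier)
  qed
  ultimately consider "R = {0\<^sub>v n}" | "R = carrier_vec n"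
    using irreducible_representationD(3)[OF irr] by blast
  then show ?thesis
  proof cases
    case 2
    then show ?thesis by (auto simp: R_def)
  next
    case 1
    have "T = 0\<^sub>m n m"
    proof (rule eq_mat_by_mult_vec[OF T])
      fix v :: "complex vec" assume "v \<in> carrier_vec m"
      moreover from this have "T *\<^sub>v v \<in> R" by (auto simp: R_def)
      ultimately show "T *\<^sub>v v = 0\<^sub>m n m *\<^sub>v v" using 1 by auto
    qed auto
    then show ?thesis ..
  qed
qed

text \<open>The traces of \<open>T * S\<close> and \<open>S * T\<close> agree, and they are \<open>n\<close> and \<open>m\<close>.\<close>

lemma two_sided_inverse_imp_square:
  fixes T S :: "complex mat"
  assumes T: "T \<in> carrier_mat n m" and S: "S \<in> carrier_mat m n"
    and TS: "T * S = 1\<^sub>m n" and ST: "S * T = 1\<^sub>m m"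
  shows "n = m"
proof -
  have "of_nat n = (\<Sum>i<n. (T * S) $$ (i, i))" by (simp add: TS)
  also have "\<dots> = (\<Sum>i<n. \<Sum>l<m. T $$ (i, l) * S $$ (l, i))"
    by (intro sum.cong refl index_mult_mat_sum[OF T S]) auto
  also have "\<dots> = (\<Sum>l<m. \<Sum>i<n. S $$ (l, i) * T $$ (i, l))"
    by (subst sum.swap) (simp add: mult.commute)
  also have "\<dots> = (\<Sum>l<m. (S * T) $$ (l, l))"
    by (intro sum.cong refl index_mult_mat_sum[OF S T, symmetric]) auto
  also have "\<dots> = of_nat m" by (simp add: ST)
  finally have "(of_nat n :: complex) = of_nat m" .
  then show ?thesis by simp
qed

text \<open>A right inverse \<open>S\<close> has preimages of the standard unit vectors as its columns. Since
  \<open>T\<close> maps \<open>S (T v) - v\<close> to \<open>0\<close>, injectivity makes \<open>S\<close> a left inverse as well.\<close>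

lemma bijective_mat_imp_GL:
  fixes T :: "complex mat"
  assumes T: "T \<in> carrier_mat n m"
    and inj: "\<forall>v\<in>carrier_vec m. T *\<^sub>v v = 0\<^sub>v n \<longrightarrow> v = 0\<^sub>v m"
    and surj: "(\<lambda>v. T *\<^sub>v v) ` carrier_vec m = carrier_vec n"
  shows "n = m \<and> T \<in> carrier (GL n)"
proof -
  have "\<forall>j. \<exists>s. s \<in> carrier_vec m \<and> T *\<^sub>v s = unit_vec n j"
    using surj by (metis imageE unit_vec_carrier)
  then obtain s where s: "\<And>j. s j \<in> carrier_vec m" "\<And>j. T *\<^sub>v s j = unit_vec n j"
    by metis
  define S where "S = mat m n (\<lambda>(i, j). s j $ i)"
  have S: "S \<in> carrier_mat m n" by (simp add: S_def)
  have colS: "col S j = s j" if "j < n" for j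
    using that s(1)[of j] by (intro eq_vecI) (auto simp: S_def)
  have TS: "T * S = 1\<^sub>m n"
  proof (rule mat_col_eqI)
    fix j assume "j < dim_col (1\<^sub>m n :: complex mat)"
    then have j: "j < n" by simp
    show "col (T * S) j = col (1\<^sub>m n) j"
      using col_mult2[OF T S j] s colS[OF j] j by simp
  qed (use T S in auto)
  have ST: "S * T = 1\<^sub>m m"
  proof (rule eq_mat_by_mult_vec)
    fix v :: "complex vec" assume v: "v \<in> carrier_vec m"
    have Tv: "T *\<^sub>v v \<in> carrier_vec n" and STv: "S *\<^sub>v (T *\<^sub>v v) \<in> carrier_vec m"
      using T S v by auto
    have "T *\<^sub>v (S *\<^sub>v (T *\<^sub>v v)) = (T * S) *\<^sub>v (T *\<^sub>v v)"
      using T S Tv by (intro assoc_mult_mat_vec[symmetric])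
    also have "\<dots> = T *\<^sub>v v" using TS Tv by simp
    finally have "T *\<^sub>v (S *\<^sub>v (T *\<^sub>v v) - v) = 0\<^sub>v n"
      using T S v Tv STv by (simp add: mult_minus_distrib_mat_vec)
    then have diff: "S *\<^sub>v (T *\<^sub>v v) - v = 0\<^sub>v m" using inj STv v by auto
    have "S *\<^sub>v (T *\<^sub>v v) = v"
    proof (rule eq_vecI)
      fix i assume "i < dim_vec v"
      then show "(S *\<^sub>v (T *\<^sub>v v)) $ i = v $ i"
        using arg_cong[OF diff, of "\<lambda>u. u $ i"] STv v by simp
    qed (use S STv v in auto)
    then show "(S * T) *\<^sub>v v = 1\<^sub>m m *\<^sub>v v"
      using assoc_mult_mat_vec[OF S T v] v by simp
  qed (use S T in auto)
  have nm: "n = m" by (rule two_sided_inverse_imp_square[OF T S TS ST])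
  have "T \<in> carrier (GL n)"
    using T S TS ST unfolding nm by (auto simp: GL_def units_of_def Units_def ring_mat_def)
  with nm show ?thesis by blast
qed

lemma schur_nonisomorphic:
  assumes \<rho>: "irreducible_representation G n \<rho>" and \<sigma>: "irreducible_representation G m \<sigma>"
    and T: "T \<in> carrier_mat n m"
    and com: "\<And>x. x \<in> carrier G \<Longrightarrow> T * \<sigma> x = \<rho> x * T"
    and niso: "\<not> isomorphic_representations G m \<sigma> n \<rho>"
  shows "T = 0\<^sub>m n m"
proof (rule ccontr)
  assume "T \<noteq> 0\<^sub>m n m"
  then have "n = m \<and> T \<in> carrier (GL n)"
    using intertwiner_zero_or_injective[OF \<sigma> T _ com]
      intertwiner_zero_or_surjective[OF \<rho> T _ com]
      representation_carrier[OF irreducible_representationD(1)[OF \<rho>]]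
      representation_carrier[OF irreducible_representationD(1)[OF \<sigma>]]
    by (intro bijective_mat_imp_GL[OF T]) blast+
  then show False using niso com by (auto simp: isomorphic_representations_def)
qed

text \<open>Over the complex numbers \<open>T\<close> has an eigenvalue \<open>c\<close>. The intertwiner \<open>T - c\<close> is then not
  injective, so it vanishes.\<close>

lemma schur_scalar:
  assumes \<rho>: "irreducible_representation G n \<rho>" and T: "T \<in> carrier_mat n n"
    and com: "\<And>x. x \<in> carrier G \<Longrightarrow> T * \<rho> x = \<rho> x * T"
  shows "\<exists>c. T = c \<cdot>\<^sub>m 1\<^sub>m n"
proof -
  note \<rho>c = representation_carrier[OF irreducible_representationD(1)[OF \<rho>]]
  obtain c where "eigenvalue T c"
    using spectrum_non_empty[OF T irreducible_representationD(2)[OF \<rho>]]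
    by (auto simp: spectrum_def)
  define S where "S = char_matrix T c"
  have S: "S \<in> carrier_mat n n" using T by (simp add: S_def)
  obtain v where v: "v \<in> carrier_vec n" "v \<noteq> 0\<^sub>v n" "S *\<^sub>v v = 0\<^sub>v n"
    using \<open>eigenvalue T c\<close> eigenvalue_char_matrix[OF T] by (auto simp: S_def)
  have Sdef: "S = T + (- c) \<cdot>\<^sub>m 1\<^sub>m n" using T by (auto simp: S_def char_matrix_def)
  have "S * \<rho> x = \<rho> x * S" if x: "x \<in> carrier G" for x
  proof -
    have "(- c) \<cdot>\<^sub>m 1\<^sub>m n * \<rho> x = (- c) \<cdot>\<^sub>m \<rho> x"
      using mult_smult_assoc_mat[of "1\<^sub>m n" n n "\<rho> x" n "- c"] \<rho>c[OF x] by simp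
    moreover have "\<rho> x * ((- c) \<cdot>\<^sub>m 1\<^sub>m n) = (- c) \<cdot>\<^sub>m \<rho> x"
      using mult_smult_distrib[of "\<rho> x" n n "1\<^sub>m n" n "- c"] \<rho>c[OF x] by simp
    ultimately show ?thesis
      using \<rho>c[OF x] T com[OF x] unfolding Sdef
      by (simp add: add_mult_distrib_mat[where n = n] mult_add_distrib_mat[where n = n])
  qed
  then have "S = 0\<^sub>m n n"
    using intertwiner_zero_or_injective[of G n \<rho> S n \<rho>] \<rho> S \<rho>c v by auto
  then have "T = c \<cdot>\<^sub>m 1\<^sub>m n"
  proof (intro eq_matI)
    fix i j assume "i < dim_row (c \<cdot>\<^sub>m 1\<^sub>m n)" "j < dim_col (c \<cdot>\<^sub>m 1\<^sub>m n)"
    then show "T $$ (i, j) = (c \<cdot>\<^sub>m 1\<^sub>m n) $$ (i, j)"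
      using arg_cong[OF \<open>S = 0\<^sub>m n n\<close>, of "\<lambda>M. M $$ (i, j)"] T by (simp add: Sdef)
  qed (use T in auto)
  then show ?thesis ..
qed

section \<open>Orthogonality of matrix coefficients\<close>

lemma (in group) sum_left_translate:
  assumes y: "y \<in> carrier G"
  shows "(\<Sum>x\<in>carrier G. g (y \<otimes> x)) = (\<Sum>x\<in>carrier G. g x)"
  by (rule sum.reindex_bij_witness[where i = "\<lambda>x. inv y \<otimes> x" and j = "\<lambda>x. y \<otimes> x"])
    (use y in \<open>auto simp: m_assoc[symmetric]\<close>)

lemma (in group) sum_right_translate:
  assumes y: "y \<in> carrier G"
  shows "(\<Sum>x\<in>carrier G. g (x \<otimes> y)) = (\<Sum>x\<in>carrier G. g x)"
  by (rule sum.reindex_bij_witness[where i = "\<lambda>x. x \<otimes> inv y" and j = "\<lambda>x. x \<otimes> y"])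
    (use y in \<open>auto simp: m_assoc\<close>)

text \<open>Orthonormal columns \<open>U j a\<close> preserve inner products. The vectors \<open>U j\<close> will be rows of
  a representing matrix or coordinates of the vectors of an orthonormal basis.\<close>

lemma sum_isometry:
  fixes U :: "'j \<Rightarrow> 'a \<Rightarrow> complex"
  assumes fin: "finite A"
    and orth: "\<And>a b. a \<in> A \<Longrightarrow> b \<in> A \<Longrightarrow> (\<Sum>j\<in>J. U j a * cnj (U j b)) = (if a = b then 1 else 0)"
  shows "(\<Sum>j\<in>J. (\<Sum>a\<in>A. U j a * u a) * cnj (\<Sum>b\<in>A. U j b * v b)) = (\<Sum>a\<in>A. u a * cnj (v a))"
proof -
  have "(\<Sum>j\<in>J. (\<Sum>a\<in>A. U j a * u a) * cnj (\<Sum>b\<in>A. U j b * v b))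
      = (\<Sum>j\<in>J. \<Sum>a\<in>A. \<Sum>b\<in>A. u a * cnj (v b) * (U j a * cnj (U j b)))"
    by (simp add: sum_product algebra_simps)
  also have "\<dots> = (\<Sum>a\<in>A. \<Sum>j\<in>J. \<Sum>b\<in>A. u a * cnj (v b) * (U j a * cnj (U j b)))"
    by (rule sum.swap)
  also have "\<dots> = (\<Sum>a\<in>A. \<Sum>b\<in>A. \<Sum>j\<in>J. u a * cnj (v b) * (U j a * cnj (U j b)))"
    by (intro sum.cong refl sum.swap)
  also have "\<dots> = (\<Sum>a\<in>A. \<Sum>b\<in>A. if a = b then u a * cnj (v b) else 0)"
    by (intro sum.cong refl) (simp add: sum_distrib_left[symmetric] orth)
  also have "\<dots> = (\<Sum>a\<in>A. u a * cnj (v a))"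
    using fin by (intro sum.cong refl) (simp add: sum.delta)
  finally show ?thesis .
qed

text \<open>In matrix notation \<open>T\<close> is the sum over \<open>x\<close> of \<open>\<rho> x\<close> times the elementary matrix with entry
  \<open>1\<close> at \<open>(k, l)\<close> times the adjoint of \<open>\<sigma> x\<close>. Replacing \<open>x\<close> by \<open>y \<otimes> x\<close> in the sum shows that
  \<open>T\<close> equals \<open>\<rho> y * T\<close> times the adjoint of \<open>\<sigma> y\<close>, and the adjoint of \<open>\<sigma> y\<close> is its inverse.\<close>

lemma coefficient_average_intertwines:
  fixes G (structure)
  assumes G: "group G"
    and \<rho>: "representation G n \<rho>" and \<sigma>: "representation G m \<sigma>"
    and unit: "\<And>x. x \<in> carrier G \<Longrightarrow> unitary_matrix m (\<sigma> x)"
    and k: "k < n" and l: "l < m" and y: "y \<in> carrier G"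
  defines "T \<equiv> mat n m (\<lambda>(a, b). \<Sum>x\<in>carrier G. \<rho> x $$ (a, k) * cnj (\<sigma> x $$ (b, l)))"
  shows "T * \<sigma> y = \<rho> y * T"
proof (rule eq_matI)
  interpret group G by fact
  note \<rho>c = representation_carrier[OF \<rho>] and \<sigma>c = representation_carrier[OF \<sigma>]
  have T: "T \<in> carrier_mat n m" by (simp add: T_def)
  fix a b assume "a < dim_row (\<rho> y * T)" "b < dim_col (\<rho> y * T)"
  then have a: "a < n" and b: "b < m" using \<rho>c[OF y] T by auto
  have \<sigma>yx: "\<sigma> (y \<otimes> x) $$ (c, l) = (\<Sum>e<m. \<sigma> y $$ (c, e) * \<sigma> x $$ (e, l))"
    if "c < m" "x \<in> carrier G" for c x
    using that by (simp add: representation_mult[OF \<sigma> y] index_mult_mat_sum[OF \<sigma>c[OF y] \<sigma>c] l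
      del: index_mult_mat)
  have \<rho>yx: "\<rho> (y \<otimes> x) $$ (a, k) = (\<Sum>c<n. \<rho> y $$ (a, c) * \<rho> x $$ (c, k))"
    if "x \<in> carrier G" for x
    using that by (simp add: representation_mult[OF \<rho> y] index_mult_mat_sum[OF \<rho>c[OF y] \<rho>c] a k
      del: index_mult_mat)
  have "(T * \<sigma> y) $$ (a, b)
      = (\<Sum>c<m. (\<Sum>x\<in>carrier G. \<rho> x $$ (a, k) * cnj (\<sigma> x $$ (c, l))) * \<sigma> y $$ (c, b))"
    unfolding index_mult_mat_sum[OF T \<sigma>c[OF y] a b]
    by (intro sum.cong) (auto simp: T_def a)
  also have "\<dots> = (\<Sum>c<m. (\<Sum>x\<in>carrier G. \<rho> (y \<otimes> x) $$ (a, k) * cnj (\<sigma> (y \<otimes> x) $$ (c, l)))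
                    * \<sigma> y $$ (c, b))"
    by (subst sum_left_translate[OF y]) (rule refl)
  also have "\<dots> = (\<Sum>c<m. \<Sum>x\<in>carrier G.
      \<rho> (y \<otimes> x) $$ (a, k) * (\<sigma> y $$ (c, b) * cnj (\<sigma> (y \<otimes> x) $$ (c, l))))"
    by (simp add: sum_distrib_left mult_ac)
  also have "\<dots> = (\<Sum>x\<in>carrier G. \<rho> (y \<otimes> x) $$ (a, k) *
      (\<Sum>c<m. \<sigma> y $$ (c, b) * cnj (\<sigma> (y \<otimes> x) $$ (c, l))))"
    by (subst sum.swap) (simp add: sum_distrib_left)
  also have "\<dots> = (\<Sum>x\<in>carrier G. \<rho> (y \<otimes> x) $$ (a, k) * cnj (\<sigma> x $$ (b, l)))"
  proof (intro sum.cong refl arg_cong2[where f = "(*)"])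
    fix x assume x: "x \<in> carrier G"
    \<comment> \<open>Writing column \<open>b\<close> of \<open>\<sigma> y\<close> as the image of a unit vector exposes
      an inner product of two images under \<open>\<sigma> y\<close>.\<close>
    have "(\<Sum>c<m. \<sigma> y $$ (c, b) * cnj (\<sigma> (y \<otimes> x) $$ (c, l)))
        = (\<Sum>c<m. (\<Sum>e<m. \<sigma> y $$ (c, e) * (if e = b then 1 else 0)) *
             cnj (\<Sum>e<m. \<sigma> y $$ (c, e) * \<sigma> x $$ (e, l)))"
      using b x by (intro sum.cong refl) (simp add: \<sigma>yx if_distrib sum.delta cong: if_cong)
    also have "\<dots> = (\<Sum>e<m. (if e = b then 1 else 0) * cnj (\<sigma> x $$ (e, l)))"
      by (rule sum_isometry) (use unitary_matrix_columns[OF unit[OF y]] in auto)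
    also have "\<dots> = cnj (\<sigma> x $$ (b, l))"
      using b by (simp add: if_distrib if_distribR sum.delta cong: if_cong)
    finally show "(\<Sum>c<m. \<sigma> y $$ (c, b) * cnj (\<sigma> (y \<otimes> x) $$ (c, l))) = cnj (\<sigma> x $$ (b, l))" .
  qed
  also have "\<dots> = (\<Sum>x\<in>carrier G. \<Sum>c<n. \<rho> y $$ (a, c) * (\<rho> x $$ (c, k) * cnj (\<sigma> x $$ (b, l))))"
    by (simp add: \<rho>yx sum_distrib_right mult.assoc)
  also have "\<dots> = (\<Sum>c<n. \<rho> y $$ (a, c) * T $$ (c, b))"
    by (subst sum.swap) (simp add: T_def b sum_distrib_left)
  also have "\<dots> = (\<rho> y * T) $$ (a, b)"
    by (rule index_mult_mat_sum[OF \<rho>c[OF y] T a b, symmetric])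
  finally show "(T * \<sigma> y) $$ (a, b) = (\<rho> y * T) $$ (a, b)" .
qed (use representation_carrier[OF \<rho> y] representation_carrier[OF \<sigma> y] in \<open>auto simp: T_def\<close>)

lemma schur_orthogonality_nonisomorphic:
  assumes G: "group G"
    and \<rho>: "irreducible_representation G n \<rho>" and \<sigma>: "irreducible_representation G m \<sigma>"
    and unit: "\<And>x. x \<in> carrier G \<Longrightarrow> unitary_matrix m (\<sigma> x)"
    and niso: "\<not> isomorphic_representations G m \<sigma> n \<rho>"
    and ix: "a < n" "k < n" "b < m" "l < m"
  shows "(\<Sum>x\<in>carrier G. \<rho> x $$ (a, k) * cnj (\<sigma> x $$ (b, l))) = 0"
proof -
  define T where "T = mat n m (\<lambda>(a, b). \<Sum>x\<in>carrier G. \<rho> x $$ (a, k) * cnj (\<sigma> x $$ (b, l)))"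
  have T: "T \<in> carrier_mat n m" by (simp add: T_def)
  have "T = 0\<^sub>m n m"
    by (rule schur_nonisomorphic[OF \<rho> \<sigma> T _ niso], unfold T_def)
      (rule coefficient_average_intertwines[OF G irreducible_representationD(1)[OF \<rho>]
        irreducible_representationD(1)[OF \<sigma>] unit \<open>k < n\<close> \<open>l < m\<close>])
  then have "T $$ (a, b) = 0" using ix by simp
  then show ?thesis using ix by (simp add: T_def)
qed

text \<open>The average is a scalar matrix by Schur's lemma. Its trace is a sum of inner products of
  columns of the unitary matrices \<open>\<rho> x\<close>, which fixes the scalar.\<close>

lemma schur_orthogonality_same:
  assumes G: "group G"
    and \<rho>: "irreducible_representation G n \<rho>"
    and unit: "\<And>x. x \<in> carrier G \<Longrightarrow> unitary_matrix n (\<rho> x)"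
    and ix: "a < n" "k < n" "b < n" "l < n"
  shows "of_nat n * (\<Sum>x\<in>carrier G. \<rho> x $$ (a, k) * cnj (\<rho> x $$ (b, l)))
    = (if a = b \<and> k = l then of_nat (card (carrier G)) else 0)"
proof -
  define T where "T = mat n n (\<lambda>(a, b). \<Sum>x\<in>carrier G. \<rho> x $$ (a, k) * cnj (\<rho> x $$ (b, l)))"
  have T: "T \<in> carrier_mat n n" by (simp add: T_def)
  have "\<exists>c. T = c \<cdot>\<^sub>m 1\<^sub>m n"
    by (rule schur_scalar[OF \<rho> T], unfold T_def)
      (rule coefficient_average_intertwines[OF G irreducible_representationD(1)[OF \<rho>]
        irreducible_representationD(1)[OF \<rho>] unit \<open>k < n\<close> \<open>l < n\<close>])
  then obtain c where c: "T = c \<cdot>\<^sub>m 1\<^sub>m n" ..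
  have "of_nat n * c = (\<Sum>j<n. T $$ (j, j))" by (simp add: c)
  also have "\<dots> = (\<Sum>x\<in>carrier G. \<Sum>j<n. \<rho> x $$ (j, k) * cnj (\<rho> x $$ (j, l)))"
    by (subst sum.swap) (simp add: T_def)
  also have "\<dots> = (\<Sum>x\<in>carrier G. if k = l then 1 else 0)"
    using unitary_matrix_columns[OF unit] ix by (intro sum.cong refl) auto
  finally have nc: "of_nat n * c = (if k = l then of_nat (card (carrier G)) else 0)" by simp
  have "(\<Sum>x\<in>carrier G. \<rho> x $$ (a, k) * cnj (\<rho> x $$ (b, l))) = T $$ (a, b)"
    using ix by (simp add: T_def)
  also have "\<dots> = (if a = b then c else 0)" using ix by (simp add: c)
  finally show ?thesis using nc by auto
qed

section \<open>Matrices in an orthonormal basis\<close>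

text \<open>The matrix with columns \<open>E ! j\<close> has orthonormal columns, so its adjoint is a left inverse. For
  a square matrix this is also a right inverse, which says that the rows are orthonormal.\<close>

lemma orthonormal_basis_rows:
  assumes E: "orthonormal_basis n E" and ab: "a < n" "b < n"
  shows "(\<Sum>j<n. E ! j $ a * cnj (E ! j $ b)) = (if a = b then 1 else 0)"
proof -
  define P where "P = mat n n (\<lambda>(a, j). E ! j $ a)"
  have P: "P \<in> carrier_mat n n" by (simp add: P_def)
  note P' = mat_adjoint_carrier[OF P]
  have Ec: "E ! j \<in> carrier_vec n" if "j < n" for j
    using E that by (auto simp: orthonormal_basis_def)
  have adjP: "mat_adjoint P $$ (j, l) = cnj (E ! j $ l)" if "j < n" "l < n" for j l
    using index_mat_adjoint[OF P that] that by (simp add: P_def)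
  have "mat_adjoint P * P = 1\<^sub>m n"
  proof (rule eq_matI)
    fix j k assume "j < dim_row (1\<^sub>m n :: complex mat)" "k < dim_col (1\<^sub>m n :: complex mat)"
    then have jk: "j < n" "k < n" by auto
    have "(mat_adjoint P * P) $$ (j, k) = (\<Sum>l<n. cnj (E ! j $ l) * E ! k $ l)"
      unfolding index_mult_mat_sum[OF P' P jk]
      by (intro sum.cong refl) (auto simp: adjP jk, simp add: P_def jk)
    also have "\<dots> = E ! k \<bullet>c E ! j"
      using carrier_vecD[OF Ec[OF jk(1)]] by (auto simp: scalar_prod_def lessThan_atLeast0 mult.commute intro!: sum.cong)
    also have "\<dots> = 1\<^sub>m n $$ (j, k)" using E jk by (auto simp: orthonormal_basis_def)
    finally show "(mat_adjoint P * P) $$ (j, k) = 1\<^sub>m n $$ (j, k)" .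
  qed (use P P' in auto)
  then have PP': "P * mat_adjoint P = 1\<^sub>m n"
    by (rule mat_mult_left_right_inverse[OF P' P])
  have "(\<Sum>j<n. E ! j $ a * cnj (E ! j $ b)) = (P * mat_adjoint P) $$ (a, b)"
    unfolding index_mult_mat_sum[OF P P' ab]
    by (intro sum.cong refl) (auto simp: adjP ab, simp add: P_def ab)
  then show ?thesis using ab by (simp add: PP')
qed

lemma index_matrix_in_basis:
  assumes E: "orthonormal_basis n E" and A: "A \<in> carrier_mat n n" and jk: "j < n" "k < n"
  shows "matrix_in_basis n E A $$ (j, k)
    = (\<Sum>a<n. cnj (E ! j $ a) * (\<Sum>b<n. A $$ (a, b) * E ! k $ b))"
proof -
  have Ec: "E ! j \<in> carrier_vec n" if "j < n" for j
    using E that by (auto simp: orthonormal_basis_def)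
  have "matrix_in_basis n E A $$ (j, k) = (\<Sum>a<n. (A *\<^sub>v E ! k) $ a * cnj (E ! j $ a))"
    using jk A carrier_vecD[OF Ec[OF jk(1)]]
    by (auto simp: matrix_in_basis_def scalar_prod_def[of _ "conjugate _"] lessThan_atLeast0
      intro!: sum.cong)
  also have "\<dots> = (\<Sum>a<n. cnj (E ! j $ a) * (\<Sum>b<n. A $$ (a, b) * E ! k $ b))"
    by (intro sum.cong refl) (simp add: index_mult_mat_vec_sum[OF A Ec[OF jk(2)]] mult.commute
      del: index_mult_mat_vec)
  finally show ?thesis .
qed

text \<open>In coordinates the basis change multiplies by a unitary matrix on the left and by its
  adjoint on the right. Each multiplication is an isometry, on the columns or on the rows.\<close>

lemma frobenius_product_in_basis:
  assumes E: "orthonormal_basis n E" and A: "A \<in> carrier_mat n n" and B: "B \<in> carrier_mat n n"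
  shows "(\<Sum>j<n. \<Sum>k<n. matrix_in_basis n E A $$ (j, k) * cnj (matrix_in_basis n E B $$ (j, k)))
    = (\<Sum>j<n. \<Sum>k<n. A $$ (j, k) * cnj (B $$ (j, k)))"
proof -
  \<comment> \<open>The entries of the columns \<open>M *\<^sub>v E ! k\<close>; the basis change is applied on the left first.\<close>
  define col_of where "col_of M k a = (\<Sum>b<n. E ! k $ b * M $$ (a, b))" for M k a
  have "(\<Sum>j<n. \<Sum>k<n. matrix_in_basis n E A $$ (j, k) * cnj (matrix_in_basis n E B $$ (j, k)))
      = (\<Sum>k<n. \<Sum>j<n. (\<Sum>a<n. cnj (E ! j $ a) * col_of A k a) *
           cnj (\<Sum>a<n. cnj (E ! j $ a) * col_of B k a))"
    by (subst sum.swap, intro sum.cong refl)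
      (simp add: index_matrix_in_basis[OF E A] index_matrix_in_basis[OF E B] col_of_def mult.commute)
  also have "\<dots> = (\<Sum>k<n. \<Sum>a<n. col_of A k a * cnj (col_of B k a))"
  proof (rule sum.cong[OF refl], rule sum_isometry)
    show "(\<Sum>j<n. cnj (E ! j $ a) * cnj (cnj (E ! j $ b))) = (if a = b then 1 else 0)"
      if "a \<in> {..<n}" "b \<in> {..<n}" for a b
      using orthonormal_basis_rows[OF E, of b a] that by (auto simp: mult.commute)
  qed auto
  also have "\<dots> = (\<Sum>a<n. \<Sum>k<n. col_of A k a * cnj (col_of B k a))"
    by (rule sum.swap)
  also have "\<dots> = (\<Sum>a<n. \<Sum>b<n. A $$ (a, b) * cnj (B $$ (a, b)))"
    unfolding col_of_def
    by (rule sum.cong[OF refl], rule sum_isometry) (use orthonormal_basis_rows[OF E] in auto)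
  finally show ?thesis .
qed

text \<open>Each summand is at most the mean of \<open>|u a|\<^sup>2\<close> and \<open>|v a|\<^sup>2\<close>, and both vectors are
  normalised.\<close>

lemma norm_inner_unit_le_1:
  fixes u v :: "'a \<Rightarrow> complex"
  assumes "(\<Sum>a\<in>A. u a * cnj (u a)) = 1" "(\<Sum>a\<in>A. v a * cnj (v a)) = 1"
  shows "norm (\<Sum>a\<in>A. cnj (v a) * u a) \<le> 1"
proof -
  have sq: "(\<Sum>a\<in>A. (norm (w a))\<^sup>2) = 1" if "(\<Sum>a\<in>A. w a * cnj (w a)) = 1" for w :: "'a \<Rightarrow> complex"
  proof -
    have "of_real (\<Sum>a\<in>A. (norm (w a))\<^sup>2) = (\<Sum>a\<in>A. w a * cnj (w a))"
      by (simp only: of_real_sum complex_norm_square)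
    then show ?thesis using that by (metis of_real_eq_1_iff)
  qed
  have "norm (\<Sum>a\<in>A. cnj (v a) * u a) \<le> (\<Sum>a\<in>A. norm (v a) * norm (u a))"
    by (rule order_trans[OF norm_sum]) (simp add: norm_mult)
  also have "\<dots> \<le> (\<Sum>a\<in>A. ((norm (v a))\<^sup>2 + (norm (u a))\<^sup>2) / 2)"
  proof (rule sum_mono)
    fix a
    show "norm (v a) * norm (u a) \<le> ((norm (v a))\<^sup>2 + (norm (u a))\<^sup>2) / 2"
      using sum_squares_bound[of "norm (v a)" "norm (u a)"] by simp
  qed
  also have "\<dots> = 1"
    using sq[OF assms(1)] sq[OF assms(2)] by (simp add: sum_divide_distrib[symmetric] sum.distrib)
  finally show ?thesis .
qed

lemma norm_unitary_in_basis_le_1: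
  assumes E: "orthonormal_basis n E" and U: "unitary_matrix n U" and jk: "j < n" "k < n"
  shows "norm (matrix_in_basis n E U $$ (j, k)) \<le> 1"
proof -
  have Uc: "U \<in> carrier_mat n n" using U by (simp add: unitary_matrix_def)
  have unit: "(\<Sum>a<n. E ! i $ a * cnj (E ! i $ a)) = 1" if "i < n" for i
  proof -
    have "E ! i \<in> carrier_vec n" using E that by (auto simp: orthonormal_basis_def)
    then have "(\<Sum>a<n. E ! i $ a * cnj (E ! i $ a)) = E ! i \<bullet>c E ! i"
      by (auto simp: scalar_prod_def lessThan_atLeast0 intro!: sum.cong)
    then show ?thesis using E that by (auto simp: orthonormal_basis_def)
  qed
  have "(\<Sum>a<n. (\<Sum>b<n. U $$ (a, b) * E ! k $ b) * cnj (\<Sum>b<n. U $$ (a, b) * E ! k $ b)) = 1"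
    unfolding unit[OF jk(2), symmetric]
    by (rule sum_isometry) (use unitary_matrix_columns[OF U] in auto)
  then show ?thesis
    unfolding index_matrix_in_basis[OF E Uc jk]
    by (rule norm_inner_unit_le_1) (rule unit[OF jk(1)])
qed

section \<open>Irreducible representations inside function spaces\<close>

interpretation function_space: vector_space "\<lambda>(c :: complex) (h :: 'g \<Rightarrow> complex) x. c * h x"
  by standard (auto simp: fun_eq_iff algebra_simps)

lemma sum_fun_apply: "(\<Sum>i\<in>A. f i) x = (\<Sum>i\<in>A. f i x :: complex)"
  by (induction A rule: infinite_finite_induct) auto

text \<open>Functions on \<open>G\<close> are represented by functions on the whole type that vanish off the carrier;
  truncation keeps translates of this form, so that equality of functions means equality on \<open>G\<close>.\<close>

definition right_translate ::
    "('g, 'b) monoid_scheme \<Rightarrow> 'g \<Rightarrow> ('g \<Rightarrow> complex) \<Rightarrow> 'g \<Rightarrow> complex" where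
  "right_translate G y h = (\<lambda>x. if x \<in> carrier G then h (x \<otimes>\<^bsub>G\<^esub> y) else 0)"

lemma right_translate_linear_combination:
  "right_translate G y (\<lambda>x. \<Sum>k\<in>K. c k * h k x) = (\<lambda>x. \<Sum>k\<in>K. c k * right_translate G y (h k) x)"
  by (auto simp: right_translate_def fun_eq_iff)

lemma (in group) right_translate_mult:
  "y \<in> carrier G \<Longrightarrow> z \<in> carrier G \<Longrightarrow>
    right_translate G (y \<otimes> z) h = right_translate G y (right_translate G z h)"
  by (auto simp: right_translate_def fun_eq_iff m_assoc)

text \<open>Multiplicativity and \<open>\<sigma> \<one> = 1\<close> already force every \<open>\<sigma> x\<close> to be invertible.\<close>

lemma representationI:
  fixes G (structure)
  assumes G: "group G"
    and car: "\<And>x. x \<in> carrier G \<Longrightarrow> \<sigma> x \<in> carrier_mat n n"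
    and mult: "\<And>x y. x \<in> carrier G \<Longrightarrow> y \<in> carrier G \<Longrightarrow> \<sigma> (x \<otimes> y) = \<sigma> x * \<sigma> y"
    and one: "\<sigma> \<one> = 1\<^sub>m n"
  shows "representation G n \<sigma>"
proof -
  interpret group G by fact
  have "\<sigma> (inv x) * \<sigma> x = 1\<^sub>m n" "\<sigma> x * \<sigma> (inv x) = 1\<^sub>m n" if "x \<in> carrier G" for x
    using that by (simp_all add: mult[symmetric] one)
  then show ?thesis
    using car mult inv_closed
    by (fastforce simp: representation_def hom_def GL_def units_of_def Units_def ring_mat_def)
qed

text \<open>A subspace that contains as many independent vectors as a spanning set of the large
  space has elements is the whole space: a further vector would make an independent set too large
  for the span.\<close>

lemma subspace_in_finite_span_eqI:
  fixes V W :: "('g \<Rightarrow> complex) set"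
  assumes "function_space.subspace W" "W \<subseteq> V" "finite B" "V \<subseteq> function_space.span B"
    and "function_space.independent B'" "B' \<subseteq> W" "card B \<le> card B'"
  shows "W = V"
proof (rule ccontr)
  assume "W \<noteq> V"
  then obtain v where v: "v \<in> V" "v \<notin> W" using assms(2) by blast
  have "function_space.span B' \<subseteq> W"
    using assms(1,6) by (rule function_space.span_minimal[rotated])
  then have "v \<notin> function_space.span B'" using v by blast
  then have ind: "function_space.independent (insert v B')"
    using assms(5) by (rule function_space.independent_insertI)
  have "insert v B' \<subseteq> function_space.span B" using v assms by blast
  from function_space.independent_span_bound[OF assms(3) ind this]
  have "finite (insert v B')" "card (insert v B') \<le> card B" by auto
  moreover have "v \<notin> B'" using v assms by blast
  ultimately show False using assms(7) by simp
qed

text \<open>An invariant subspace \<open>V\<close> of least positive dimension is irreducible. The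
  coordinates with respect to a basis \<open>b\<close> of \<open>V\<close> turn translation into the matrices \<open>\<sigma> y\<close>, and they
  match invariant subspaces of the coordinate space with invariant subspaces of \<open>V\<close>.\<close>

lemma invariant_space_contains_irreducible:
  fixes G :: "('g, 'b) monoid_scheme" (structure) and U :: "('g \<Rightarrow> complex) set"
  assumes G: "group G" and fin: "finite (carrier G)"
    and U: "function_space.subspace U"
    and supp: "\<forall>h\<in>U. \<forall>x. x \<notin> carrier G \<longrightarrow> h x = 0"
    and inv: "\<forall>h\<in>U. \<forall>y\<in>carrier G. right_translate G y h \<in> U"
    and ne: "U \<noteq> {0}"
  shows "\<exists>n \<sigma> b. irreducible_representation G n \<sigma> \<and> (\<forall>k<n. b k \<in> U) \<and> b 0 \<noteq> 0 \<and>
    (\<forall>y\<in>carrier G. \<forall>k<n. right_translate G y (b k) = (\<lambda>x. \<Sum>j<n. \<sigma> y $$ (j, k) * b j x))"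
proof -
  interpret group G by fact
  define good where "good V \<longleftrightarrow> function_space.subspace V \<and> V \<subseteq> U \<and>
    (\<forall>y\<in>carrier G. \<forall>h\<in>V. right_translate G y h \<in> V) \<and> V \<noteq> {0}" for V
  \<comment> \<open>The point masses span all functions on the finite group, so dimensions below are finite.\<close>
  define D where "D = (\<lambda>x z. if z = x then 1 else 0 :: complex) ` carrier G"
  have UD: "U \<subseteq> function_space.span D"
  proof
    fix h assume h: "h \<in> U"
    have "h = (\<Sum>x\<in>carrier G. (\<lambda>z. h x * (if z = x then 1 else 0)))"
    proof
      fix z
      show "h z = (\<Sum>x\<in>carrier G. (\<lambda>z. h x * (if z = x then 1 else 0))) z"
        using fin supp h
        by (simp add: sum_fun_apply if_distrib sum.delta cong: if_cong)
    qed
    also have "\<dots> \<in> function_space.span D"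
      by (intro function_space.span_sum function_space.span_scale function_space.span_base)
        (auto simp: D_def)
    finally show "h \<in> function_space.span D" .
  qed
  have basis: "\<exists>B. finite B \<and> function_space.independent B \<and> B \<subseteq> V \<and> V \<subseteq> function_space.span B \<and>
      function_space.dim V = card B" if "good V" for V
  proof -
    obtain B where B: "B \<subseteq> V" "function_space.independent B" "V \<subseteq> function_space.span B"
      by (rule function_space.maximal_independent_subset)
    have "finite B"
      using function_space.independent_span_bound[OF _ B(2)] B(1) UD \<open>good V\<close> fin
      by (auto simp: good_def D_def)
    moreover have "function_space.dim V = card B"
      using function_space.basis_card_eq_dim[OF B(1,3,2)] by simp
    ultimately show ?thesis using B by blast
  qed
  have "good U" using U inv ne by (auto simp: good_def)
  then obtain V where V: "good V"
    and least: "\<And>W. good W \<Longrightarrow> function_space.dim V \<le> function_space.dim W"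
    using ex_has_least_nat[of good U function_space.dim] by blast
  have Vsub: "function_space.subspace V" and VU: "V \<subseteq> U"
    and Vinv: "\<And>y h. y \<in> carrier G \<Longrightarrow> h \<in> V \<Longrightarrow> right_translate G y h \<in> V"
    using V by (auto simp: good_def)
  obtain B where B: "finite B" "function_space.independent B" "B \<subseteq> V"
      "V \<subseteq> function_space.span B" "function_space.dim V = card B"
    using basis[OF V] by blast
  have minimal: "W = V" if W: "good W" "W \<subseteq> V" for W
  proof -
    obtain B' where B': "function_space.independent B'" "B' \<subseteq> W"
      "function_space.dim W = card B'"
      using basis[OF W(1)] by blast
    have "card B \<le> card B'" using least[OF W(1)] B(5) B'(3) by simp
    moreover have "function_space.subspace W" using W(1) by (simp add: good_def)
    ultimately show ?thesis
      using subspace_in_finite_span_eqI[of W V B B'] W(2) B B' by blast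
  qed
  define n where "n = card B"
  obtain b where b: "bij_betw b {..<n} B"
    using ex_bij_betw_nat_finite[OF B(1)] by (auto simp: n_def lessThan_atLeast0)
  have bV: "b k \<in> V" if "k < n" for k
    using b B(3) that by (auto simp: bij_betw_def)
  \<comment> \<open>The coordinate isomorphism from vectors of length \<open>n\<close> onto \<open>V\<close>.\<close>
  define L where "L v = (\<lambda>x. \<Sum>k<n. v $ k * b k x)" for v :: "complex vec"
  have L_eq: "L v = (\<Sum>k<n. (\<lambda>x. v $ k * b k x))" for v
    by (simp add: L_def fun_eq_iff sum_fun_apply)
  have L_V: "L v \<in> V" for v
    unfolding L_eq using bV
    by (intro function_space.subspace_sum[OF Vsub] function_space.subspace_scale[OF Vsub]) auto
  have L_surj: "\<exists>v\<in>carrier_vec n. L v = h" if h: "h \<in> V" for h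
  proof -
    obtain u where u: "h = (\<Sum>c\<in>B. (\<lambda>x. u c * c x))"
      using h B(4) function_space.span_finite[OF B(1)] by blast
    have "h = (\<Sum>k<n. (\<lambda>x. u (b k) * b k x))"
      unfolding u by (rule sum.reindex_bij_betw[OF b, symmetric])
    also have "\<dots> = L (vec n (\<lambda>k. u (b k)))" by (simp add: L_eq)
    finally show ?thesis by (metis vec_carrier)
  qed
  have L_add: "L (v + w) = L v + L w" if "v \<in> carrier_vec n" "w \<in> carrier_vec n" for v w
    using that by (auto simp: L_def fun_eq_iff algebra_simps sum.distrib)
  have L_smult: "L (c \<cdot>\<^sub>v v) = (\<lambda>x. c * L v x)" if "v \<in> carrier_vec n" for c v
    using that by (auto simp: L_def fun_eq_iff sum_distrib_left mult.assoc)
  have L_inj: "v = w" if eq: "L v = L w" and vw: "v \<in> carrier_vec n" "w \<in> carrier_vec n" for v w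
  proof (rule eq_vecI)
    define u where "u c = v $ inv_into {..<n} b c - w $ inv_into {..<n} b c" for c
    have ub: "u (b k) = v $ k - w $ k" if "k < n" for k
      using that b by (simp add: u_def bij_betw_inv_into_left)
    have "(\<Sum>c\<in>B. (\<lambda>x. u c * c x)) = (\<Sum>k<n. (\<lambda>x. u (b k) * b k x))"
      by (rule sum.reindex_bij_betw[OF b, symmetric])
    also have "\<dots> = 0"
    proof
      fix x
      show "(\<Sum>k<n. (\<lambda>x. u (b k) * b k x)) x = 0 x"
        using fun_cong[OF eq, of x] by (simp add: sum_fun_apply ub L_def algebra_simps sum_subtractf)
    qed
    finally have "u c = 0" if "c \<in> B" for c
      using function_space.independentD[OF B(2,1) order_refl] that by blast
    then have "u (b k) = 0" if "k < n" for k
      using b that by (auto simp: bij_betw_def)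
    then show "v $ k = w $ k" if "k < dim_vec w" for k
      using ub[of k] that vw by auto
  qed (use vw in auto)
  have "\<forall>y k. \<exists>c. y \<in> carrier G \<longrightarrow> k < n \<longrightarrow> c \<in> carrier_vec n \<and> L c = right_translate G y (b k)"
    using L_surj Vinv bV by metis
  then obtain c where c: "\<And>y k. y \<in> carrier G \<Longrightarrow> k < n \<Longrightarrow>
      c y k \<in> carrier_vec n \<and> L (c y k) = right_translate G y (b k)"
    by metis
  define \<sigma> where "\<sigma> y = mat n n (\<lambda>(j, k). c y k $ j)" for y
  have \<sigma>c: "\<sigma> y \<in> carrier_mat n n" for y by (simp add: \<sigma>_def)
  have \<sigma>b: "right_translate G y (b k) = (\<lambda>x. \<Sum>j<n. \<sigma> y $$ (j, k) * b j x)"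
    if "y \<in> carrier G" "k < n" for y k
    using c[OF that] that(2) by (simp add: \<sigma>_def L_def fun_eq_iff)
  have L_\<sigma>: "L (\<sigma> y *\<^sub>v v) = right_translate G y (L v)"
    if y: "y \<in> carrier G" and v: "v \<in> carrier_vec n" for y v
  proof
    fix x
    have "L (\<sigma> y *\<^sub>v v) x = (\<Sum>j<n. \<Sum>k<n. v $ k * (\<sigma> y $$ (j, k) * b j x))"
      unfolding L_def
    proof (rule sum.cong[OF refl])
      fix j assume "j \<in> {..<n}"
      then have "(\<sigma> y *\<^sub>v v) $ j = (\<Sum>k<n. \<sigma> y $$ (j, k) * v $ k)"
        by (intro index_mult_mat_vec_sum[OF \<sigma>c v]) simp
      then show "(\<sigma> y *\<^sub>v v) $ j * b j x = (\<Sum>k<n. v $ k * (\<sigma> y $$ (j, k) * b j x))"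
        by (simp add: sum_distrib_left mult_ac)
    qed
    also have "\<dots> = (\<Sum>k<n. v $ k * (\<Sum>j<n. \<sigma> y $$ (j, k) * b j x))"
      by (subst sum.swap) (simp add: sum_distrib_left)
    also have "\<dots> = right_translate G y (L v) x"
      unfolding L_def right_translate_linear_combination by (simp add: \<sigma>b[OF y])
    finally show "L (\<sigma> y *\<^sub>v v) x = right_translate G y (L v) x" .
  qed
  have \<sigma>v: "\<sigma> y *\<^sub>v v \<in> carrier_vec n" if "v \<in> carrier_vec n" for y v
    using \<sigma>c that by (rule mult_mat_vec_carrier)
  have rep: "representation G n \<sigma>"
  proof (rule representationI[OF G \<sigma>c])
    fix y z assume yz: "y \<in> carrier G" "z \<in> carrier G"
    show "\<sigma> (y \<otimes> z) = \<sigma> y * \<sigma> z"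
    proof (rule eq_mat_by_mult_vec[OF \<sigma>c mult_carrier_mat[OF \<sigma>c \<sigma>c]])
      fix v :: "complex vec" assume v: "v \<in> carrier_vec n"
      have "L (\<sigma> (y \<otimes> z) *\<^sub>v v) = L (\<sigma> y *\<^sub>v (\<sigma> z *\<^sub>v v))"
        using yz v \<sigma>v by (simp add: L_\<sigma> right_translate_mult)
      then have "\<sigma> (y \<otimes> z) *\<^sub>v v = \<sigma> y *\<^sub>v (\<sigma> z *\<^sub>v v)"
        by (rule L_inj) (use v \<sigma>v in auto)
      then show "\<sigma> (y \<otimes> z) *\<^sub>v v = \<sigma> y * \<sigma> z *\<^sub>v v"
        by (simp only: assoc_mult_mat_vec[OF \<sigma>c \<sigma>c v])
    qed
  next
    show "\<sigma> \<one> = 1\<^sub>m n"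
    proof (rule eq_mat_by_mult_vec[OF \<sigma>c])
      fix v :: "complex vec" assume v: "v \<in> carrier_vec n"
      have "L v \<in> U" using L_V VU by blast
      then have "L (\<sigma> \<one> *\<^sub>v v) = L v"
        using v supp by (auto simp: L_\<sigma> right_translate_def fun_eq_iff)
      then have "\<sigma> \<one> *\<^sub>v v = v" by (rule L_inj) (use v \<sigma>v in auto)
      then show "\<sigma> \<one> *\<^sub>v v = 1\<^sub>m n *\<^sub>v v" using v by simp
    qed simp
  qed
  have n0: "n > 0"
  proof (rule ccontr)
    assume "\<not> n > 0"
    then have "h = 0" if "h \<in> V" for h
      using L_surj[OF that] by (auto simp: L_def zero_fun_def)
    then show False
      using V function_space.subspace_0[OF Vsub] by (auto simp: good_def)
  qed
  have L0: "L (0\<^sub>v n) = 0" by (simp add: L_def zero_fun_def)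
  have "irreducible_representation G n \<sigma>"
    unfolding irreducible_representation_def
  proof (intro conjI allI impI rep n0)
    fix S assume "linear_subspace n S \<and> (\<forall>x\<in>carrier G. \<forall>v\<in>S. \<sigma> x *\<^sub>v v \<in> S)"
    then have Sc: "S \<subseteq> carrier_vec n" and S0: "0\<^sub>v n \<in> S"
      and Sadd: "\<And>v w. v \<in> S \<Longrightarrow> w \<in> S \<Longrightarrow> v + w \<in> S" and Ssm: "\<And>c v. v \<in> S \<Longrightarrow> c \<cdot>\<^sub>v v \<in> S"
      and Sinv: "\<And>x v. x \<in> carrier G \<Longrightarrow> v \<in> S \<Longrightarrow> \<sigma> x *\<^sub>v v \<in> S"
      by (auto simp: linear_subspace_def)
    show "S = {0\<^sub>v n} \<or> S = carrier_vec n"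
    proof (cases "S = {0\<^sub>v n}")
      case False
      then obtain s where s: "s \<in> S" "s \<noteq> 0\<^sub>v n" using S0 by blast
      have "good (L ` S)"
        unfolding good_def
      proof (intro conjI ballI)
        show "function_space.subspace (L ` S)"
        proof (rule function_space.subspaceI)
          show "0 \<in> L ` S" using L0 S0 by (metis imageI)
        next
          fix g h assume "g \<in> L ` S" "h \<in> L ` S"
          then obtain v w where "v \<in> S" "w \<in> S" "g = L v" "h = L w" by blast
          moreover from this have "g + h = L (v + w)"
            by (simp add: L_add[OF subsetD[OF Sc] subsetD[OF Sc]])
          ultimately show "g + h \<in> L ` S" using Sadd by blast
        next
          fix c h assume "h \<in> L ` S"
          then obtain v where "v \<in> S" "h = L v" by blast
          moreover from this have "(\<lambda>x. c * h x) = L (c \<cdot>\<^sub>v v)"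
            by (simp add: L_smult[OF subsetD[OF Sc]])
          ultimately show "(\<lambda>x. c * h x) \<in> L ` S" using Ssm by blast
        qed
        show "L ` S \<subseteq> U" using L_V VU by blast
        show "right_translate G y h \<in> L ` S" if y: "y \<in> carrier G" and h: "h \<in> L ` S" for y h
        proof -
          obtain v where v: "v \<in> S" "h = L v" using h by blast
          have "right_translate G y h = L (\<sigma> y *\<^sub>v v)"
            using L_\<sigma>[OF y, of v] v Sc by auto
          then show ?thesis using Sinv[OF y v(1)] by blast
        qed
        have "L s \<noteq> 0"
        proof
          assume "L s = 0"
          then have "s = 0\<^sub>v n" by (intro L_inj) (use L0 s Sc in auto)
          then show False using s by simp
        qed
        then show "L ` S \<noteq> {0}" using s by blast
      qed
      moreover have "L ` S \<subseteq> V" using L_V by blast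
      ultimately have LS: "L ` S = V" by (rule minimal)
      have "v \<in> S" if v: "v \<in> carrier_vec n" for v
      proof -
        obtain w where "w \<in> S" "L v = L w" using L_V[of v] LS by auto
        then show ?thesis using L_inj[of v w] v Sc by blast
      qed
      then show ?thesis using Sc by blast
    qed simp
  qed
  moreover have "b 0 \<noteq> 0"
  proof -
    have "b 0 \<in> B" using b n0 by (auto simp: bij_betw_def)
    then show ?thesis using B(2) function_space.dependent_zero[of B] by metis
  qed
  moreover have "\<forall>k<n. b k \<in> U" using bV VU by blast
  moreover have "\<forall>y\<in>carrier G. \<forall>k<n.
      right_translate G y (b k) = (\<lambda>x. \<Sum>j<n. \<sigma> y $$ (j, k) * b j x)"
    using \<sigma>b by blast
  ultimately show ?thesis by (intro exI conjI)
qed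

section \<open>Fourier inversion\<close>

lemma orthogonal_to_linear_combination:
  fixes h :: "'g \<Rightarrow> complex"
  assumes "\<And>j. j \<in> J \<Longrightarrow> (\<Sum>x\<in>X. h x * cnj (g j x)) = 0"
  shows "(\<Sum>x\<in>X. h x * cnj (\<Sum>j\<in>J. c j * g j x)) = 0"
proof -
  have "(\<Sum>x\<in>X. h x * cnj (\<Sum>j\<in>J. c j * g j x)) = (\<Sum>x\<in>X. \<Sum>j\<in>J. cnj (c j) * (h x * cnj (g j x)))"
    by (simp add: sum_distrib_left mult_ac)
  also have "\<dots> = (\<Sum>j\<in>J. cnj (c j) * (\<Sum>x\<in>X. h x * cnj (g j x)))"
    by (subst sum.swap) (simp add: sum_distrib_left)
  finally show ?thesis using assms by simp
qed

text \<open>Suppose a non-zero function is orthogonal to all matrix coefficients. Orthogonality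
  is preserved by right translation, so an irreducible \<open>\<sigma>\<close> occurs on such functions
  \<open>b 0, b 1, ...\<close>. Evaluating translates at the identity gives
  \<open>b 0 x = right_translate G x (b 0) \<one>\<close>, a linear combination of entries of \<open>\<sigma> x\<close>, and thus, by
  the isomorphism of \<open>\<sigma>\<close> with some \<open>\<rho> i\<close>, of entries of \<open>\<rho> i x\<close>. Hence \<open>b 0\<close> is orthogonal to
  itself.\<close>

lemma matrix_coefficients_complete:
  fixes G :: "('g, 'b) monoid_scheme" (structure)
  assumes G: "group G" and fin: "finite (carrier G)"
    and irr: "complete_irreducibles G t d \<rho>"
    and orth: "\<And>i j k. i \<in> {1..t} \<Longrightarrow> j < d i \<Longrightarrow> k < d i \<Longrightarrow>
      (\<Sum>x\<in>carrier G. h x * cnj (\<rho> i x $$ (j, k))) = 0"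
    and x0: "x0 \<in> carrier G"
  shows "h x0 = 0"
proof (rule ccontr)
  assume nz: "h x0 \<noteq> 0"
  interpret group G by fact
  have rep: "representation G (d i) (\<rho> i)" if "i \<in> {1..t}" for i
    using irr that irreducible_representationD(1) unfolding complete_irreducibles_def by blast
  define U where "U = {h :: 'g \<Rightarrow> complex. (\<forall>x. x \<notin> carrier G \<longrightarrow> h x = 0) \<and>
    (\<forall>i\<in>{1..t}. \<forall>j<d i. \<forall>k<d i. (\<Sum>x\<in>carrier G. h x * cnj (\<rho> i x $$ (j, k))) = 0)}"
  have U_orth: "(\<Sum>x\<in>carrier G. h x * cnj (\<rho> i x $$ (j, k))) = 0"
    if "h \<in> U" "i \<in> {1..t}" "j < d i" "k < d i" for h i j k
    using that by (auto simp: U_def)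
  have U_subspace: "function_space.subspace U"
    by (rule function_space.subspaceI)
      (simp_all add: U_def distrib_right sum.distrib mult.assoc flip: sum_distrib_left)
  have U_invariant: "\<forall>h\<in>U. \<forall>y\<in>carrier G. right_translate G y h \<in> U"
  proof (intro ballI)
    fix h y assume h: "h \<in> U" and y: "y \<in> carrier G"
    have "(\<Sum>x\<in>carrier G. right_translate G y h x * cnj (\<rho> i x $$ (j, k))) = 0"
      if i: "i \<in> {1..t}" and jk: "j < d i" "k < d i" for i j k
    proof -
      note \<rho>c = representation_carrier[OF rep[OF i]]
      have "(\<Sum>x\<in>carrier G. right_translate G y h x * cnj (\<rho> i x $$ (j, k)))
          = (\<Sum>x\<in>carrier G. h (x \<otimes> y) * cnj (\<rho> i ((x \<otimes> y) \<otimes> inv y) $$ (j, k)))"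
        using y by (intro sum.cong) (auto simp: right_translate_def m_assoc)
      also have "\<dots> = (\<Sum>x\<in>carrier G. h x * cnj (\<rho> i (x \<otimes> inv y) $$ (j, k)))"
        by (rule sum_right_translate[OF y])
      also have "\<dots> = (\<Sum>x\<in>carrier G. h x *
          cnj (\<Sum>l<d i. \<rho> i (inv y) $$ (l, k) * \<rho> i x $$ (j, l)))"
      proof (intro sum.cong refl arg_cong2[where f = "(*)"] arg_cong[where f = cnj])
        fix x assume x: "x \<in> carrier G"
        show "\<rho> i (x \<otimes> inv y) $$ (j, k) = (\<Sum>l<d i. \<rho> i (inv y) $$ (l, k) * \<rho> i x $$ (j, l))"
          unfolding representation_mult[OF rep[OF i] x inv_closed[OF y]]
            index_mult_mat_sum[OF \<rho>c[OF x] \<rho>c[OF inv_closed[OF y]] jk]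
          by (simp add: mult.commute)
      qed
      also have "\<dots> = 0"
        by (rule orthogonal_to_linear_combination) (use U_orth[OF h i] jk in auto)
      finally show ?thesis .
    qed
    moreover have "\<forall>x. x \<notin> carrier G \<longrightarrow> right_translate G y h x = 0"
      by (simp add: right_translate_def)
    ultimately show "right_translate G y h \<in> U" unfolding U_def by blast
  qed
  have U_nonzero: "U \<noteq> {0}"
  proof -
    have "(\<lambda>x. if x \<in> carrier G then h x else 0) \<in> U"
      using orth by (simp add: U_def)
    moreover have "(\<lambda>x. if x \<in> carrier G then h x else 0) \<noteq> 0"
      using nz x0 by (auto simp: fun_eq_iff)
    ultimately show ?thesis by blast
  qed
  have U_supp: "\<forall>h\<in>U. \<forall>x. x \<notin> carrier G \<longrightarrow> h x = 0"
    by (simp add: U_def)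
  obtain n \<sigma> b where \<sigma>: "irreducible_representation G n \<sigma>"
    and bU: "\<forall>k<n. b k \<in> U" and b0: "b 0 \<noteq> 0"
    and trans: "\<forall>y\<in>carrier G. \<forall>k<n. right_translate G y (b k) = (\<lambda>x. \<Sum>j<n. \<sigma> y $$ (j, k) * b j x)"
    using invariant_space_contains_irreducible[OF G fin U_subspace U_supp U_invariant U_nonzero]
    by blast
  have n: "0 < n" using irreducible_representationD(2)[OF \<sigma>] .
  obtain i where i: "i \<in> {1..t}" and iso: "isomorphic_representations G n \<sigma> (d i) (\<rho> i)"
    using irr \<sigma> unfolding complete_irreducibles_def by blast
  then obtain P where nd: "n = d i" and P: "P \<in> carrier (GL n)"
    and com: "\<And>x. x \<in> carrier G \<Longrightarrow> P * \<sigma> x = \<rho> i x * P"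
    by (auto simp: isomorphic_representations_def)
  obtain Q where Pc: "P \<in> carrier_mat n n" and Q: "Q \<in> carrier_mat n n" and QP: "Q * P = 1\<^sub>m n"
    using P by (auto simp: GL_def units_of_def Units_def ring_mat_def)
  note \<rho>c = representation_carrier[OF rep[OF i], folded nd]
  note \<sigma>c = representation_carrier[OF irreducible_representationD(1)[OF \<sigma>]]
  have \<sigma>_eq: "\<sigma> x = Q * (\<rho> i x * P)" if x: "x \<in> carrier G" for x
  proof -
    have "Q * (\<rho> i x * P) = (Q * P) * \<sigma> x"
      unfolding com[OF x, symmetric] using Q Pc \<sigma>c[OF x] by (intro assoc_mult_mat[symmetric])
    then show ?thesis using QP \<sigma>c[OF x] by simp
  qed
  have b0_eq: "b 0 x = (\<Sum>j<n. b j \<one> * (\<Sum>a<n. Q $$ (j, a) * (\<Sum>c<n. P $$ (c, 0) * \<rho> i x $$ (a, c))))"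
    if x: "x \<in> carrier G" for x
  proof -
    have "b 0 x = right_translate G x (b 0) \<one>"
      using x by (simp add: right_translate_def)
    also have "\<dots> = (\<Sum>j<n. b j \<one> * \<sigma> x $$ (j, 0))"
      using trans x n by (simp add: mult.commute)
    also have "\<dots> = (\<Sum>j<n. b j \<one> * (\<Sum>a<n. Q $$ (j, a) * (\<Sum>c<n. P $$ (c, 0) * \<rho> i x $$ (a, c))))"
    proof (intro sum.cong refl arg_cong2[where f = "(*)"])
      fix j assume "j \<in> {..<n}"
      then have j: "j < n" by simp
      have "\<sigma> x $$ (j, 0) = (\<Sum>a<n. Q $$ (j, a) * (\<rho> i x * P) $$ (a, 0))"
        unfolding \<sigma>_eq[OF x]
        by (rule index_mult_mat_sum[OF Q mult_carrier_mat[OF \<rho>c[OF x] Pc] j n])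
      also have "\<dots> = (\<Sum>a<n. Q $$ (j, a) * (\<Sum>c<n. P $$ (c, 0) * \<rho> i x $$ (a, c)))"
        by (intro sum.cong refl arg_cong2[where f = "(*)"])
          (simp add: index_mult_mat_sum[OF \<rho>c[OF x] Pc _ n] mult.commute del: index_mult_mat)
      finally show "\<sigma> x $$ (j, 0) = (\<Sum>a<n. Q $$ (j, a) * (\<Sum>c<n. P $$ (c, 0) * \<rho> i x $$ (a, c)))" .
    qed
    finally show ?thesis .
  qed
  have b0U: "b 0 \<in> U" using bU n by blast
  have "of_real (\<Sum>x\<in>carrier G. (norm (b 0 x))\<^sup>2) = (\<Sum>x\<in>carrier G. b 0 x * cnj (b 0 x))"
    by (simp only: of_real_sum complex_norm_square)
  also have "\<dots> = (\<Sum>x\<in>carrier G. b 0 x *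
      cnj (\<Sum>j<n. b j \<one> * (\<Sum>a<n. Q $$ (j, a) * (\<Sum>c<n. P $$ (c, 0) * \<rho> i x $$ (a, c)))))"
    using b0_eq by (intro sum.cong refl) simp
  also have "\<dots> = 0"
    by (intro orthogonal_to_linear_combination) (use U_orth[OF b0U i] nd in auto)
  finally have "(\<Sum>x\<in>carrier G. (norm (b 0 x))\<^sup>2) = 0" by (simp only: of_real_eq_0_iff)
  then have "b 0 x = 0" if "x \<in> carrier G" for x
    using fin that by (simp add: sum_nonneg_eq_0_iff)
  moreover have "b 0 x = 0" if "x \<notin> carrier G" for x
    using b0U that by (auto simp: U_def)
  ultimately have "b 0 = 0" by (auto simp: fun_eq_iff)
  with b0 show False ..
qed

lemma schur_orthogonality:
  assumes G: "group G" and irr: "complete_irreducibles G t d \<rho>"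
    and unit: "\<forall>i\<in>{1..t}. \<forall>x\<in>carrier G. unitary_matrix (d i) (\<rho> i x)"
    and ix: "i \<in> {1..t}" "i' \<in> {1..t}" "j < d i" "k < d i" "j' < d i'" "k' < d i'"
  shows "of_nat (d i') * (\<Sum>x\<in>carrier G. \<rho> i x $$ (j, k) * cnj (\<rho> i' x $$ (j', k')))
    = (if i = i' \<and> j = j' \<and> k = k' then of_nat (card (carrier G)) else 0)"
proof -
  have irr': "irreducible_representation G (d i) (\<rho> i)" if "i \<in> {1..t}" for i
    using irr that unfolding complete_irreducibles_def by blast
  show ?thesis
  proof (cases "i = i'")
    case True
    have "unitary_matrix (d i) (\<rho> i x)" if "x \<in> carrier G" for x
      using unit ix(1) that by blast
    from schur_orthogonality_same[OF G irr'[OF ix(1)] this ix(3,4) ix(5,6)[folded True]]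
    show ?thesis by (simp add: True)
  next
    case False
    then have "\<not> isomorphic_representations G (d i') (\<rho> i') (d i) (\<rho> i)"
      using irr ix(1,2) unfolding complete_irreducibles_def by metis
    moreover have "unitary_matrix (d i') (\<rho> i' x)" if "x \<in> carrier G" for x
      using unit ix(2) that by blast
    ultimately show ?thesis
      using schur_orthogonality_nonisomorphic[OF G irr'[OF ix(1)] irr'[OF ix(2)] _ _ ix(3-6)] False
      by simp
  qed
qed

text \<open>By Schur orthogonality the right-hand side, as a function \<open>R\<close> of the point, has the same
  Fourier transform as \<open>|G| f\<close>; completeness of the matrix coefficients, applied to the complex
  conjugate of the difference, yields equality.\<close>

lemma fourier_inversion:
  fixes f :: "'g \<Rightarrow> complex"
  assumes G: "group G" and fin: "finite (carrier G)" and irr: "complete_irreducibles G t d \<rho>"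
    and unit: "\<forall>i\<in>{1..t}. \<forall>x\<in>carrier G. unitary_matrix (d i) (\<rho> i x)"
    and x0: "x0 \<in> carrier G"
  shows "of_nat (card (carrier G)) * f x0 = (\<Sum>i=1..t. of_nat (d i) *
    (\<Sum>j<d i. \<Sum>k<d i. fourier_transform G f (d i) (\<rho> i) $$ (j, k) * cnj (\<rho> i x0 $$ (j, k))))"
proof -
  define F where "F i j k = fourier_transform G f (d i) (\<rho> i) $$ (j, k)" for i j k
  define R where "R x = (\<Sum>i=1..t. of_nat (d i) *
    (\<Sum>j<d i. \<Sum>k<d i. F i j k * cnj (\<rho> i x $$ (j, k))))" for x
  have F: "F i j k = (\<Sum>x\<in>carrier G. f x * \<rho> i x $$ (j, k))" if "j < d i" "k < d i" for i j k
    using that by (simp add: F_def fourier_transform_def)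
  have R: "(\<Sum>x\<in>carrier G. R x * \<rho> i x $$ (j, k)) = of_nat (card (carrier G)) * F i j k"
    if i: "i \<in> {1..t}" and jk: "j < d i" "k < d i" for i j k
  proof -
    define S where "S i' j' k' = (\<Sum>x\<in>carrier G. \<rho> i x $$ (j, k) * cnj (\<rho> i' x $$ (j', k')))"
      for i' j' k'
    have "(\<Sum>x\<in>carrier G. R x * \<rho> i x $$ (j, k))
        = (\<Sum>x\<in>carrier G. \<Sum>i'=1..t. \<Sum>j'<d i'. \<Sum>k'<d i'.
             F i' j' k' * (of_nat (d i') * (\<rho> i x $$ (j, k) * cnj (\<rho> i' x $$ (j', k')))))"
      by (simp only: R_def sum_distrib_left sum_distrib_right) (simp only: mult_ac)
    also have "\<dots> = (\<Sum>i'=1..t. \<Sum>j'<d i'. \<Sum>k'<d i'. \<Sum>x\<in>carrier G.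
             F i' j' k' * (of_nat (d i') * (\<rho> i x $$ (j, k) * cnj (\<rho> i' x $$ (j', k')))))"
      by (simp only: sum.swap[of _ _ "carrier G"])
    also have "\<dots> = (\<Sum>i'=1..t. \<Sum>j'<d i'. \<Sum>k'<d i'. F i' j' k' * (of_nat (d i') * S i' j' k'))"
      by (simp add: S_def sum_distrib_left)
    also have "\<dots> = (\<Sum>i'=1..t. \<Sum>j'<d i'. \<Sum>k'<d i'.
        if k' = k then if j' = j then if i' = i then F i' j' k' * of_nat (card (carrier G)) else 0 else 0 else 0)"
      unfolding S_def by (intro sum.cong refl)
        (subst schur_orthogonality[OF G irr unit], use i jk in auto)
    also have "\<dots> = (\<Sum>i'=1..t. if i' = i then F i' j k * of_nat (card (carrier G)) else 0)"
    proof (rule sum.cong[OF refl])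
      fix i'
      show "(\<Sum>j'<d i'. \<Sum>k'<d i'.
          if k' = k then if j' = j then if i' = i then F i' j' k' * of_nat (card (carrier G)) else 0 else 0 else 0)
        = (if i' = i then F i' j k * of_nat (card (carrier G)) else 0)"
        using jk by (cases "i' = i") (simp_all add: sum.delta)
    qed
    also have "\<dots> = of_nat (card (carrier G)) * F i j k"
      using i by simp
    finally show ?thesis .
  qed
  have "cnj (of_nat (card (carrier G)) * f x0 - R x0) = 0"
  proof (rule matrix_coefficients_complete[OF G fin irr _ x0])
    fix i j k assume ijk: "i \<in> {1..t}" "j < d i" "k < d i"
    have "(\<Sum>x\<in>carrier G. cnj (of_nat (card (carrier G)) * f x - R x) * cnj (\<rho> i x $$ (j, k)))
        = cnj (of_nat (card (carrier G)) * (\<Sum>x\<in>carrier G. f x * \<rho> i x $$ (j, k))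
            - (\<Sum>x\<in>carrier G. R x * \<rho> i x $$ (j, k)))"
      by (simp add: algebra_simps sum_subtractf sum_distrib_left)
    then show "(\<Sum>x\<in>carrier G. cnj (of_nat (card (carrier G)) * f x - R x) * cnj (\<rho> i x $$ (j, k))) = 0"
      using R[OF ijk] F[OF ijk(2,3)] by simp
  qed
  then show ?thesis
    by (simp only: complex_cnj_zero_iff right_minus_eq R_def F_def)
qed

section \<open>The uncertainty inequality\<close>

text \<open>Passing to a basis is linear, so an entry of the transform is the combination, with
  coefficients \<open>f x\<close>, of entries of the unitary matrices \<open>\<rho> x\<close>.\<close>

lemma norm_fourier_coefficient_le:
  fixes f :: "'g \<Rightarrow> complex"
  assumes unit: "\<And>x. x \<in> carrier G \<Longrightarrow> unitary_matrix n (\<rho> x)"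
    and E: "orthonormal_basis n E" and jk: "j < n" "k < n"
  shows "norm (matrix_in_basis n E (fourier_transform G f n \<rho>) $$ (j, k)) \<le> (\<Sum>x\<in>carrier G. norm (f x))"
proof -
  have Fc: "fourier_transform G f n \<rho> \<in> carrier_mat n n" by (simp add: fourier_transform_def)
  have \<rho>c: "\<rho> x \<in> carrier_mat n n" if "x \<in> carrier G" for x
    using unit[OF that] by (simp add: unitary_matrix_def)
  have "matrix_in_basis n E (fourier_transform G f n \<rho>) $$ (j, k)
      = (\<Sum>a<n. \<Sum>b<n. \<Sum>x\<in>carrier G. f x * (cnj (E ! j $ a) * (\<rho> x $$ (a, b) * E ! k $ b)))"
    unfolding index_matrix_in_basis[OF E Fc jk]
    by (simp add: fourier_transform_def sum_distrib_left sum_distrib_right) (simp only: mult_ac)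
  also have "\<dots> = (\<Sum>x\<in>carrier G. \<Sum>a<n. \<Sum>b<n. f x * (cnj (E ! j $ a) * (\<rho> x $$ (a, b) * E ! k $ b)))"
    by (simp only: sum.swap[of _ "carrier G"])
  also have "\<dots> = (\<Sum>x\<in>carrier G. f x * matrix_in_basis n E (\<rho> x) $$ (j, k))"
    by (intro sum.cong refl) (simp add: index_matrix_in_basis[OF E \<rho>c jk] sum_distrib_left)
  finally have "norm (matrix_in_basis n E (fourier_transform G f n \<rho>) $$ (j, k))
      \<le> (\<Sum>x\<in>carrier G. norm (f x) * norm (matrix_in_basis n E (\<rho> x) $$ (j, k)))"
    using norm_sum[of "\<lambda>x. f x * matrix_in_basis n E (\<rho> x) $$ (j, k)" "carrier G"]
    by (simp add: norm_mult)
  also have "\<dots> \<le> (\<Sum>x\<in>carrier G. norm (f x))"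
    using norm_unitary_in_basis_le_1[OF E unit jk] by (intro sum_mono) (simp add: mult_left_le)
  finally show ?thesis .
qed

lemma norm_frobenius_product_le:
  fixes A B :: "complex mat"
  assumes A: "A \<in> carrier_mat n n"
    and bA: "\<And>j k. j < n \<Longrightarrow> k < n \<Longrightarrow> norm (A $$ (j, k)) \<le> s"
    and bB: "\<And>j k. j < n \<Longrightarrow> k < n \<Longrightarrow> norm (B $$ (j, k)) \<le> 1"
  shows "norm (\<Sum>j<n. \<Sum>k<n. A $$ (j, k) * cnj (B $$ (j, k))) \<le> real (card (mat_supp A)) * s"
proof -
  have sub: "mat_supp A \<subseteq> {..<n} \<times> {..<n}" using A by (auto simp: mat_supp_def)
  have "(\<Sum>j<n. \<Sum>k<n. A $$ (j, k) * cnj (B $$ (j, k)))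
      = (\<Sum>p\<in>{..<n} \<times> {..<n}. A $$ p * cnj (B $$ p))"
    by (simp add: sum.cartesian_product case_prod_unfold)
  also have "\<dots> = (\<Sum>p\<in>mat_supp A. A $$ p * cnj (B $$ p))"
    by (rule sum.mono_neutral_right) (use sub A in \<open>auto simp: mat_supp_def\<close>)
  also have "norm \<dots> \<le> (\<Sum>p\<in>mat_supp A. s)"
  proof (rule order_trans[OF norm_sum], rule sum_mono)
    fix p assume "p \<in> mat_supp A"
    then obtain j k where p: "p = (j, k)" "j < n" "k < n" using sub by auto
    have "norm (A $$ p * cnj (B $$ p)) \<le> norm (A $$ p)"
      using bB[OF p(2,3)] by (simp add: p(1) norm_mult mult_left_le)
    also have "\<dots> \<le> s" using bA[OF p(2,3)] p(1) by simp
    finally show "norm (A $$ p * cnj (B $$ p)) \<le> s" .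
  qed
  finally show ?thesis by simp
qed

lemma orthonormal_basis_unit_vecs:
  "orthonormal_basis n (map (unit_vec n) [0..<n])"
  by (auto simp: orthonormal_basis_def unit_vec_def scalar_prod_def if_distrib sum.delta cong: if_cong)

text \<open>The least element exists because there is at least one choice of bases, the standard ones.\<close>

lemma fourier_min_supp_size_attained:
  obtains E where "\<forall>i\<in>{1..t}. orthonormal_basis (d i) (E i)"
    and "fourier_min_supp_size G t d \<rho> f = fourier_supp_size G t d \<rho> f E"
proof -
  have "\<forall>i\<in>{1..t}. orthonormal_basis (d i) (map (unit_vec (d i)) [0..<d i])"
    by (simp add: orthonormal_basis_unit_vecs)
  then have "\<exists>s E. (\<forall>i\<in>{1..t}. orthonormal_basis (d i) (E i)) \<and> s = fourier_supp_size G t d \<rho> f E"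
    by (intro exI[of _ "fourier_supp_size G t d \<rho> f (\<lambda>i. map (unit_vec (d i)) [0..<d i])"]
      exI[of _ "\<lambda>i. map (unit_vec (d i)) [0..<d i]"]) simp
  from LeastI_ex[OF this] that show ?thesis
    unfolding fourier_min_supp_size_def by blast
qed

theorem theorem3p10:
  fixes G :: "('g, 'b) monoid_scheme"
    and t :: nat and d :: "nat \<Rightarrow> nat" and \<rho> :: "nat \<Rightarrow> 'g \<Rightarrow> complex mat"
    and f :: "'g \<Rightarrow> complex"
  assumes "group G" and "finite (carrier G)"
    and "complete_irreducibles G t d \<rho>"
    and "\<forall>i\<in>{1..t}. \<forall>x\<in>carrier G. unitary_matrix (d i) (\<rho> i x)"
    and "\<exists>x\<in>carrier G. f x \<noteq> 0"
  shows "card (fun_supp G f) * fourier_min_supp_size G t d \<rho> f \<ge> card (carrier G)"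
proof -
  note G = assms(1) and fin = assms(2) and irr = assms(3) and unit = assms(4)
  obtain E where E: "\<And>i. i \<in> {1..t} \<Longrightarrow> orthonormal_basis (d i) (E i)"
    and min: "fourier_min_supp_size G t d \<rho> f = fourier_supp_size G t d \<rho> f E"
    using fourier_min_supp_size_attained by metis
  define s where "s = (\<Sum>x\<in>carrier G. norm (f x))"
  define F where "F i = fourier_transform G f (d i) (\<rho> i)" for i
  have Fc: "F i \<in> carrier_mat (d i) (d i)" for i by (simp add: F_def fourier_transform_def)
  have img: "finite ((\<lambda>x. norm (f x)) ` carrier G)" "(\<lambda>x. norm (f x)) ` carrier G \<noteq> {}"
    using fin assms(5) by auto
  obtain x0 where x0: "x0 \<in> carrier G" and "norm (f x0) = Max ((\<lambda>x. norm (f x)) ` carrier G)"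
    using Max_in[OF img] by auto
  then have max: "norm (f x) \<le> norm (f x0)" if "x \<in> carrier G" for x
    using Max_ge[OF img(1)] that by auto
  have pos: "norm (f x0) > 0" using assms(5) max by fastforce
  have "s = (\<Sum>x\<in>fun_supp G f. norm (f x))"
    unfolding s_def by (rule sum.mono_neutral_right) (use fin in \<open>auto simp: fun_supp_def\<close>)
  also have "\<dots> \<le> real (card (fun_supp G f)) * norm (f x0)"
    by (rule sum_bounded_above) (auto simp: fun_supp_def max)
  finally have s: "s \<le> real (card (fun_supp G f)) * norm (f x0)" .
  have "real (card (carrier G)) * norm (f x0) = norm (of_nat (card (carrier G)) * f x0)"
    by (simp add: norm_mult)
  also have "\<dots> \<le> (\<Sum>i=1..t. real (d i) * (real (card (mat_supp (matrix_in_basis (d i) (E i) (F i)))) * s))"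
    unfolding fourier_inversion[OF G fin irr unit x0] F_def[symmetric]
  proof (rule order_trans[OF norm_sum], rule sum_mono)
    fix i assume i: "i \<in> {1..t}"
    have \<rho>c: "\<rho> i x0 \<in> carrier_mat (d i) (d i)"
      using unit i x0 by (simp add: unitary_matrix_def)
    have "norm (\<Sum>j<d i. \<Sum>k<d i. F i $$ (j, k) * cnj (\<rho> i x0 $$ (j, k)))
        \<le> real (card (mat_supp (matrix_in_basis (d i) (E i) (F i)))) * s"
      unfolding frobenius_product_in_basis[OF E[OF i] Fc \<rho>c, symmetric]
    proof (rule norm_frobenius_product_le)
      show "matrix_in_basis (d i) (E i) (F i) \<in> carrier_mat (d i) (d i)"
        by (simp add: matrix_in_basis_def)
      show "norm (matrix_in_basis (d i) (E i) (F i) $$ (j, k)) \<le> s" if "j < d i" "k < d i" for j k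
        unfolding F_def s_def using unit i E that by (intro norm_fourier_coefficient_le) auto
      show "norm (matrix_in_basis (d i) (E i) (\<rho> i x0) $$ (j, k)) \<le> 1" if "j < d i" "k < d i" for j k
        using unit i x0 E that by (intro norm_unitary_in_basis_le_1) auto
    qed
    then show "norm (of_nat (d i) * (\<Sum>j<d i. \<Sum>k<d i. F i $$ (j, k) * cnj (\<rho> i x0 $$ (j, k))))
        \<le> real (d i) * (real (card (mat_supp (matrix_in_basis (d i) (E i) (F i)))) * s)"
      by (simp add: norm_mult mult_left_mono)
  qed
  also have "\<dots> = real (fourier_min_supp_size G t d \<rho> f) * s"
    unfolding min fourier_supp_size_def F_def by (simp add: sum_distrib_right mult.assoc)
  also have "\<dots> \<le> real (fourier_min_supp_size G t d \<rho> f) * (real (card (fun_supp G f)) * norm (f x0))"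
    using s by (intro mult_left_mono) auto
  finally have "real (card (carrier G)) * norm (f x0)
      \<le> real (card (fun_supp G f) * fourier_min_supp_size G t d \<rho> f) * norm (f x0)"
    by (simp add: mult_ac)
  then have "real (card (carrier G)) \<le> real (card (fun_supp G f) * fourier_min_supp_size G t d \<rho> f)"
    using pos by (simp only: mult_le_cancel_right_pos)
  then show ?thesis by (simp only: of_nat_le_iff)
qed

end
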